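(* Let $K$ be an origin symmetric convex body in $\mathbb{R}^2$ which has a square as an inscribed parallelogram of maximum area. Let $\varepsilon\in[0,1)$. If $\delta_{\rm vol}(K,W^2)\ge\varepsilon$ or $\delta_{\rm BM}(K,W^2)\ge \varepsilon$, then $$\frac{S(K)^2}{V(K)}\le\left(1-\frac{\varepsilon}{54}\right)\frac{S(W^2)^2}{V(W^2)}.$$
   Context: A convex body in $\mathbb{R}^2$ is a compact convex set with non-empty interior. $V(\cdot)$ denotes area (2-dimensional volume) and $S(\cdot)$ denotes perimeter (surface area in $\mathbb{R}^2$). $W^2=[-1,1]^2$. An inscribed parallelogram of maximum area is a parallelogram contained in $K$ whose area is maximal among all parallelograms contained in $K$; the hypothesis is that some such maximizer is a square. For origin symmetric convex bodies $K,M$ in $\mathbb{R}^2$, put $\alpha=V(K)^{-1/2}$, $\beta=V(M)^{-1/2}$ and define $$\delta_{\rm vol}(K,M)=\min\{V(\Phi(\alpha K)\,\Delta\,(\beta M)):\Phi\in {\rm SL}(2)\},$$ where $\Delta$ is the symmetric difference of sets, and $$\delta_{\rm BM}(K,M)=\log\min\{\lambda\ge 1:\ K\subseteq \Phi(M)\subseteq \lambda K\text{ for some }\Phi\in {\rm GL}(2)\}.$$ *)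

theory Defs
  imports "HOL-Analysis.Analysis"
begin

definition convex_body :: "(real^2) set \<Rightarrow> bool" where
  "convex_body K \<longleftrightarrow> compact K \<and> convex K \<and> interior K \<noteq> {}"

definition origin_symmetric :: "(real^2) set \<Rightarrow> bool" where
  "origin_symmetric K \<longleftrightarrow> uminus ` K = K"

definition area :: "(real^2) set \<Rightarrow> real" where
  "area K = measure lebesgue K"

text \<open>The one-dimensional Hausdorff measure, normalized to give length.  The library's
  \<^const>\<open>diameter\<close> is meaningless on unbounded sets, so the covering sets are required to be
  bounded; it is 0 on the empty set, so countable covers include finite ones.\<close>

definition hausdorff1_upto :: "real \<Rightarrow> 'a::metric_space set \<Rightarrow> ennreal" where
  "hausdorff1_upto d A =
     (INF U \<in> {U :: nat \<Rightarrow> 'a set. A \<subseteq> (\<Union>i. U i) \<and> (\<forall>i. bounded (U i) \<and> diameter (U i) \<le> d)}.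
        \<Sum>i. ennreal (diameter (U i)))"

definition hausdorff1 :: "'a::metric_space set \<Rightarrow> ennreal" where
  "hausdorff1 A = (SUP d \<in> {0<..}. hausdorff1_upto d A)"

text \<open>The boundary of a planar convex body has finite length, so \<^const>\<open>enn2real\<close> loses nothing
  there.\<close>

definition perimeter :: "(real^2) set \<Rightarrow> real" where
  "perimeter K = enn2real (hausdorff1 (frontier K))"

definition W2 :: "(real^2) set" where
  "W2 = {x. \<forall>i. x $ i \<in> {-1..1}}"

definition is_parallelogram :: "(real^2) set \<Rightarrow> bool" where
  "is_parallelogram P \<longleftrightarrow>
     (\<exists>a u v. \<not> collinear {0, u, v} \<and> P = convex hull {a, a + u, a + u + v, a + v})"

definition is_square :: "(real^2) set \<Rightarrow> bool" where
  "is_square P \<longleftrightarrow>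
     (\<exists>a u v. u \<noteq> 0 \<and> norm u = norm v \<and> u \<bullet> v = 0 \<and> P = convex hull {a, a + u, a + u + v, a + v})"

definition max_area_inscribed_parallelogram :: "(real^2) set \<Rightarrow> (real^2) set \<Rightarrow> bool" where
  "max_area_inscribed_parallelogram P K \<longleftrightarrow>
     is_parallelogram P \<and> P \<subseteq> K \<and> (\<forall>P'. is_parallelogram P' \<and> P' \<subseteq> K \<longrightarrow> area P' \<le> area P)"

text \<open>The two distances below are minima that are attained for origin symmetric convex bodies;
  they are written as infima of sets of reals, which are non-empty and bounded below for such
  bodies.\<close>

definition delta_vol :: "(real^2) set \<Rightarrow> (real^2) set \<Rightarrow> real" where
  "delta_vol K M =
     (let \<alpha> = area K powr (- 1 / 2); \<beta> = area M powr (- 1 / 2)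
      in INF \<Phi> \<in> {\<Phi> :: real^2^2. det \<Phi> = 1}.
           area (sym_diff ((*v) \<Phi> ` (*\<^sub>R) \<alpha> ` K) ((*\<^sub>R) \<beta> ` M)))"

definition delta_BM :: "(real^2) set \<Rightarrow> (real^2) set \<Rightarrow> real" where
  "delta_BM K M =
     ln (Inf {c :: real. 1 \<le> c \<and>
       (\<exists>\<Phi> :: real^2^2. invertible \<Phi> \<and> K \<subseteq> (*v) \<Phi> ` M \<and> (*v) \<Phi> ` M \<subseteq> (*\<^sub>R) c ` K)})"

end

theory Submission
  imports Defs
begin

text \<open>
  The proof traps \<open>K\<close> between two explicit polygons.  The perimeter of the outer one and the area of
  the inner one depend on a single parameter \<open>\<sigma> \<in> [0, 1]\<close>, and both distances of \<open>K\<close> from the square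
  are bounded in terms of \<open>\<sigma>\<close> and the area of \<open>K\<close>.

  Let \<open>p\<close> and \<open>q\<close> be the half diagonals of the square of maximal area.  They are orthogonal of equal
  length, and by symmetry and convexity \<open>\<plusminus>p\<close> and \<open>\<plusminus>q\<close> lie in \<open>K\<close> even if the square is not centred
  at the origin (max_square_half_diagonal).  The similarity that sends the axis vectors to \<open>p\<close> and
  \<open>q\<close> changes neither \<open>S(K)\<^sup>2 / V(K)\<close> nor the two distances, so let \<open>p = (1, 0)\<close> and \<open>q = (0, 1)\<close>.
  For \<open>x\<close> and \<open>y\<close> in \<open>K\<close> the parallelogram with vertices \<open>\<plusminus>x, \<plusminus>y\<close> lies in \<open>K\<close> and has area
  \<open>2 \<bar>det (x, y)\<bar>\<close>, so that maximality gives \<open>\<bar>det (x, y)\<bar> \<le> 1\<close> on \<open>K\<close>.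

  Let \<open>1 + s\<close> and \<open>1 + t\<close> be the maxima over \<open>K\<close> of \<open>x\<^sub>1 + x\<^sub>2\<close> and of \<open>x\<^sub>2 - x\<^sub>1\<close>, and put
  \<open>\<sigma> = s + t\<close>.  The determinant bound gives \<open>K \<subseteq> [-1, 1]\<^sup>2\<close> (take \<open>y\<close> to be an axis vector) and
  \<open>\<sigma> \<le> 1\<close> (take \<open>x\<close> and \<open>y\<close> to be the two maximizers); this is octagon_of_unimodular_body.  Hence:

  \<^item> \<open>K\<close> lies in an octagon of perimeter \<open>P = 4 \<surd>2 + (4 - 2 \<surd>2) \<sigma>\<close>, and \<open>S(K) \<le> P\<close> because
    perimeter is monotone on convex sets (hausdorff1_frontier_convex_mono);
  \<^item> \<open>K\<close> contains the diamond \<open>D = {\<bar>x\<^sub>1\<bar> + \<bar>x\<^sub>2\<bar> \<le> 1}\<close> and four triangles over its sides, so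
    \<open>V(K) \<ge> 2 + \<sigma>\<close> (area_ge_diamond_plus_caps);
  \<^item> \<open>D \<subseteq> K \<subseteq> (1 + \<sigma>) D\<close>, and \<open>D\<close> is a linear image of the square, so
    \<open>\<delta>\<^sub>B\<^sub>M \<le> ln (1 + \<sigma>) \<le> \<sigma>\<close> and \<open>\<delta>\<^sub>v\<^sub>o\<^sub>l \<le> 2 (1 - 2 / V(K))\<close> (delta_BM_le, delta_vol_le).

  What remains is the inequality \<open>P\<^sup>2 \<le> 16 (1 - \<epsilon> / 54) V(K)\<close> between real numbers
  (isoperimetric_inequality_numeric).  It is an equality at \<open>\<sigma> = \<epsilon> = 0\<close>, \<open>V(K) = 2\<close>, and its slack is
  at least proportional to \<open>\<sigma>\<close>.  The value 16 for the square itself needs its perimeter to be exactly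
  8 as a Hausdorff measure (perimeter_W2), where the lower bound comes from projecting the sides.
\<close>

section \<open>Hausdorff length\<close>

lemma hausdorff1_upto_le_cover:
  assumes "A \<subseteq> (\<Union>i::nat. U i)" "\<And>i. bounded (U i)" "\<And>i. diameter (U i) \<le> d"
  shows "hausdorff1_upto d A \<le> (\<Sum>i. ennreal (diameter (U i)))"
  unfolding hausdorff1_upto_def using assms by (intro INF_lower) auto

lemma hausdorff1_upto_near_cover:
  assumes "hausdorff1_upto d A < top" "0 < e"
  obtains U :: "nat \<Rightarrow> 'a::metric_space set" where "A \<subseteq> (\<Union>i. U i)" "\<And>i. bounded (U i)"
    "\<And>i. diameter (U i) \<le> d" "(\<Sum>i. ennreal (diameter (U i))) \<le> hausdorff1_upto d A + ennreal e"
proof -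
  have "hausdorff1_upto d A < hausdorff1_upto d A + ennreal e"
    using assms by (simp add: ennreal_add_less_top less_top)
  then show thesis
    unfolding hausdorff1_upto_def INF_less_iff
    using that unfolding hausdorff1_upto_def by (auto dest: less_imp_le)
qed

lemma hausdorff1_upto_mono: "A \<subseteq> B \<Longrightarrow> hausdorff1_upto d A \<le> hausdorff1_upto d B"
  unfolding hausdorff1_upto_def by (rule INF_superset_mono) auto

lemma hausdorff1_mono: "A \<subseteq> B \<Longrightarrow> hausdorff1 A \<le> hausdorff1 B"
  unfolding hausdorff1_def by (rule SUP_subset_mono) (simp_all add: hausdorff1_upto_mono)

lemma hausdorff1_upto_le_hausdorff1: "0 < d \<Longrightarrow> hausdorff1_upto d A \<le> hausdorff1 A"
  unfolding hausdorff1_def by (rule SUP_upper) auto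

lemma hausdorff1_leI: "(\<And>d. 0 < d \<Longrightarrow> hausdorff1_upto d A \<le> c) \<Longrightarrow> hausdorff1 A \<le> c"
  unfolding hausdorff1_def by (rule SUP_least) auto

text \<open>The images of the sets of a cover of \<open>A\<close> cover \<open>f ` A\<close>, with diameters larger by a factor of at most
  \<open>L\<close>; the mesh \<open>d / (L + 1)\<close> upstairs makes this work for \<open>L = 0\<close> as well.\<close>

lemma hausdorff1_lipschitz_image:
  fixes f :: "'a::metric_space \<Rightarrow> 'b::metric_space"
  assumes lip: "\<And>x y. x \<in> A \<Longrightarrow> y \<in> A \<Longrightarrow> dist (f x) (f y) \<le> L * dist x y" and L: "0 \<le> L"
  shows "hausdorff1 (f ` A) \<le> ennreal L * hausdorff1 A"
proof (rule hausdorff1_leI)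
  fix d :: real assume d: "0 < d"
  define e where "e = d / (L + 1)"
  have e: "0 < e" and Le: "L * e \<le> d"
    using d L by (auto simp: e_def field_simps)
  have "hausdorff1_upto d (f ` A) \<le> ennreal L * hausdorff1_upto e A"
  proof (rule ennreal_le_epsilon)
    fix r :: real assume top: "ennreal L * hausdorff1_upto e A < top" and r: "0 < r"
    show "hausdorff1_upto d (f ` A) \<le> ennreal L * hausdorff1_upto e A + ennreal r"
    proof (cases "hausdorff1_upto e A = top")
      \<comment> \<open>Here \<open>0 * \<infinity> = 0\<close>: the map is constant, and its image has length zero.\<close>
      case True
      with top have L0: "L = 0"
        using L by (auto simp: ennreal_mult_top split: if_splits)
      have "\<exists>b. f ` A \<subseteq> {b}"
      proof (cases "A = {}")
        case False
        then obtain a where "a \<in> A" by blast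
        then have "f x = f a" if "x \<in> A" for x using lip[OF that, of a] L0 by simp
        then show ?thesis by blast
      qed auto
      then obtain b where b: "f ` A \<subseteq> {b}" by blast
      have "hausdorff1_upto d (f ` A) \<le> (\<Sum>i::nat. ennreal (diameter {b}))"
        using b d by (intro hausdorff1_upto_le_cover) auto
      then show ?thesis by simp
    next
      case False
      have "0 < r / (L + 1)" using r L by simp
      then obtain U where U: "A \<subseteq> (\<Union>i. U i)" "\<And>i. bounded (U i)" "\<And>i. diameter (U i) \<le> e"
        "(\<Sum>i::nat. ennreal (diameter (U i))) \<le> hausdorff1_upto e A + ennreal (r / (L + 1))"
        using hausdorff1_upto_near_cover False by (metis less_top)
      have dist: "dist u v \<le> L * diameter (U i)" if "u \<in> f ` (U i \<inter> A)" "v \<in> f ` (U i \<inter> A)" for i u v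
        using that lip diameter_bounded_bound[OF U(2)] L
        by (auto intro!: order_trans[OF lip] mult_left_mono)
      have bd: "bounded (f ` (U i \<inter> A))" for i
        unfolding bounded_two_points using dist by blast
      have diam: "diameter (f ` (U i \<inter> A)) \<le> L * diameter (U i)" for i
      proof (cases "U i \<inter> A = {}")
        case True
        then show ?thesis using L U(2) by (simp add: diameter_ge_0)
      next
        case False
        then show ?thesis
          unfolding diameter_def[of "f ` (U i \<inter> A)"] using dist by (auto intro!: cSUP_least)
      qed
      have "hausdorff1_upto d (f ` A) \<le> (\<Sum>i. ennreal (diameter (f ` (U i \<inter> A))))"
      proof (rule hausdorff1_upto_le_cover)
        show "diameter (f ` (U i \<inter> A)) \<le> d" for i
          using diam[of i] mult_left_mono[OF U(3)[of i] L] Le by linarith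
        show "f ` A \<subseteq> (\<Union>i. f ` (U i \<inter> A))" using U(1) by blast
      qed (rule bd)
      also have "\<dots> \<le> (\<Sum>i. ennreal L * ennreal (diameter (U i)))"
        using diam L U(2) by (intro suminf_le) (auto simp flip: ennreal_mult' intro!: ennreal_leI)
      also have "\<dots> = ennreal L * (\<Sum>i. ennreal (diameter (U i)))"
        by simp
      also have "\<dots> \<le> ennreal L * (hausdorff1_upto e A + ennreal (r / (L + 1)))"
        using U(4) by (rule mult_left_mono) simp
      also have "\<dots> = ennreal L * hausdorff1_upto e A + ennreal (L * (r / (L + 1)))"
        using L r by (simp add: distrib_left flip: ennreal_mult')
      also have "\<dots> \<le> ennreal L * hausdorff1_upto e A + ennreal r"
        using L r by (intro add_left_mono ennreal_leI) (simp add: field_simps)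
      finally show ?thesis .
    qed
  qed
  also have "\<dots> \<le> ennreal L * hausdorff1 A"
    using e by (intro mult_left_mono hausdorff1_upto_le_hausdorff1) auto
  finally show "hausdorff1_upto d (f ` A) \<le> ennreal L * hausdorff1 A" .
qed

text \<open>Two countable covers are merged by using the even and the odd indices.\<close>

lemma hausdorff1_Un_le: "hausdorff1 (A \<union> B) \<le> hausdorff1 A + hausdorff1 B"
proof (rule hausdorff1_leI)
  fix d :: real assume d: "0 < d"
  let ?h = "hausdorff1_upto d"
  have "?h (A \<union> B) \<le> ?h A + ?h B"
  proof (rule ennreal_le_epsilon)
    fix e :: real assume fin: "?h A + ?h B < top" and e: "0 < e"
    have fin': "?h A < top" "?h B < top" "0 < e / 2"
      using fin e by (auto simp: ennreal_add_less_top less_top)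
    obtain U where U: "A \<subseteq> (\<Union>i. U i)" "\<And>i. bounded (U i)" "\<And>i. diameter (U i) \<le> d"
        "(\<Sum>i::nat. ennreal (diameter (U i))) \<le> ?h A + ennreal (e / 2)"
      using hausdorff1_upto_near_cover[OF fin'(1,3)] by blast
    obtain V where V: "B \<subseteq> (\<Union>i. V i)" "\<And>i. bounded (V i)" "\<And>i. diameter (V i) \<le> d"
        "(\<Sum>i::nat. ennreal (diameter (V i))) \<le> ?h B + ennreal (e / 2)"
      using hausdorff1_upto_near_cover[OF fin'(2,3)] by blast
    define W where "W i = (if even i then U (i div 2) else V (i div 2))" for i :: nat
    let ?s = "\<lambda>U n. \<Sum>i<n. ennreal (diameter (U i))"
    have W: "W (2 * i) = U i" "W (Suc (2 * i)) = V i" for i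
      by (auto simp: W_def)
    have split: "?s W (2 * n) = ?s U n + ?s V n" for n
      by (induction n) (auto simp: W W[unfolded mult.commute[of 2]] ac_simps)
    have "?h (A \<union> B) \<le> (\<Sum>i. ennreal (diameter (W i)))"
    proof (rule hausdorff1_upto_le_cover)
      show "A \<union> B \<subseteq> (\<Union>i. W i)"
        using U(1) V(1) by (fastforce simp flip: W)
    qed (auto simp: W_def U V)
    also have "\<dots> \<le> (\<Sum>i. ennreal (diameter (U i))) + (\<Sum>i. ennreal (diameter (V i)))"
    proof (rule suminf_le_const)
      fix n
      have "?s W n \<le> ?s W (2 * n)"
        by (rule sum_mono2) auto
      also have "\<dots> \<le> (\<Sum>i. ennreal (diameter (U i))) + (\<Sum>i. ennreal (diameter (V i)))"
        unfolding split by (intro add_mono sum_le_suminf) auto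
      finally show "?s W n \<le> (\<Sum>i. ennreal (diameter (U i))) + (\<Sum>i. ennreal (diameter (V i)))" .
    qed simp
    also have "\<dots> \<le> (?h A + ennreal (e / 2)) + (?h B + ennreal (e / 2))"
      by (intro add_mono U V)
    also have "\<dots> = ?h A + ?h B + ennreal e"
      using e by (simp add: add_ac flip: ennreal_plus)
    finally show "?h (A \<union> B) \<le> ?h A + ?h B + ennreal e" .
  qed
  also have "\<dots> \<le> hausdorff1 A + hausdorff1 B"
    using d by (intro add_mono hausdorff1_upto_le_hausdorff1)
  finally show "?h (A \<union> B) \<le> hausdorff1 A + hausdorff1 B" .
qed

text \<open>A set of diameter at most \<open>d\<close> meets at most one of two sets that are more than \<open>d\<close> apart, so a cover
  of the union splits into a cover of each of them.  At a fixed mesh this replaces the additivity of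
  the Hausdorff measure.\<close>

lemma hausdorff1_upto_Un_separated:
  assumes sep: "\<And>a b. a \<in> A \<Longrightarrow> b \<in> B \<Longrightarrow> d < dist a b"
  shows "hausdorff1_upto d A + hausdorff1_upto d B \<le> hausdorff1_upto d (A \<union> B)"
  unfolding hausdorff1_upto_def[of d "A \<union> B"]
proof (rule INF_greatest, clarify)
  fix U :: "nat \<Rightarrow> 'a set"
  assume U: "A \<union> B \<subseteq> (\<Union>i. U i)" "\<forall>i. bounded (U i) \<and> diameter (U i) \<le> d"
  define V where "V C i = (if U i \<inter> C = {} then {} else U i)" for C i
  have d: "0 \<le> d" using U(2) diameter_ge_0 order_trans by blast
  have disj: "U i \<inter> A = {} \<or> U i \<inter> B = {}" for i
  proof (rule ccontr)
    assume "\<not> ?thesis"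
    then obtain a b where "a \<in> U i" "a \<in> A" "b \<in> U i" "b \<in> B" by blast
    then have "d < dist a b" "dist a b \<le> diameter (U i)"
      using sep diameter_bounded_bound U(2) by blast+
    with U(2) show False by (meson not_less order_trans)
  qed
  have le: "hausdorff1_upto d C \<le> (\<Sum>i. ennreal (diameter (V C i)))" if "C \<subseteq> A \<union> B" for C
  proof (rule hausdorff1_upto_le_cover)
    show "C \<subseteq> (\<Union>i. V C i)"
    proof
      fix x assume x: "x \<in> C"
      with that U(1) obtain i where "x \<in> U i" by (metis UN_E subsetD)
      with x show "x \<in> (\<Union>i. V C i)" by (intro UN_I[of i]) (auto simp: V_def)
    qed
  qed (use U(2) d in \<open>auto simp: V_def\<close>)
  have "hausdorff1_upto d A + hausdorff1_upto d B
      \<le> (\<Sum>i. ennreal (diameter (V A i))) + (\<Sum>i. ennreal (diameter (V B i)))"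
    by (intro add_mono le) auto
  also have "\<dots> = (\<Sum>i. ennreal (diameter (V A i)) + ennreal (diameter (V B i)))"
    by (rule suminf_add) auto
  also have "\<dots> \<le> (\<Sum>i. ennreal (diameter (U i)))"
    using disj by (intro suminf_le) (auto simp: V_def)
  finally show "hausdorff1_upto d A + hausdorff1_upto d B \<le> (\<Sum>i. ennreal (diameter (U i)))" .
qed

text \<open>A nonexpansive map to the line takes a cover to sets inside intervals of the same diameters, and
  Lebesgue measure is countably subadditive.  This is the source of all lower bounds for length.\<close>

lemma hausdorff1_upto_ge_projection:
  fixes f :: "'a::metric_space \<Rightarrow> real"
  assumes lip: "\<And>x y. dist (f x) (f y) \<le> dist x y" and ab: "{a..b} \<subseteq> f ` A"
  shows "ennreal (b - a) \<le> hausdorff1_upto d A"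
  unfolding hausdorff1_upto_def
proof (rule INF_greatest, clarify)
  fix U :: "nat \<Rightarrow> 'a set"
  assume U: "A \<subseteq> (\<Union>i. U i)" "\<forall>i. bounded (U i) \<and> diameter (U i) \<le> d"
  have "\<exists>l u. f ` U i \<subseteq> {l..u} \<and> u - l = diameter (U i)" for i
  proof (cases "U i = {}")
    case True
    then show ?thesis by (auto intro: exI[of _ 0])
  next
    case False
    have bd: "bounded (U i)" using U(2) by blast
    have *: "f x - f y \<le> diameter (U i)" if "x \<in> U i" "y \<in> U i" for x y
      using lip[of x y] diameter_bounded_bound[OF bd that] by (auto simp: dist_real_def)
    obtain z where z: "z \<in> U i" using False by blast
    have bb: "bdd_below (f ` U i)"
      using *[OF z] by (intro bdd_belowI[of _ "f z - diameter (U i)"]) (auto simp: algebra_simps)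
    have "f ` U i \<subseteq> {Inf (f ` U i) .. Inf (f ` U i) + diameter (U i)}"
    proof clarsimp
      fix x assume x: "x \<in> U i"
      have "f x - diameter (U i) \<le> Inf (f ` U i)"
        using False *[OF x] by (intro cINF_greatest) (auto simp: algebra_simps)
      then show "Inf (f ` U i) \<le> f x \<and> f x \<le> Inf (f ` U i) + diameter (U i)"
        using x bb by (auto intro: cINF_lower)
    qed
    then show ?thesis by (intro exI conjI) auto
  qed
  then obtain l u where lu: "\<And>i. f ` U i \<subseteq> {l i..u i}" "\<And>i. u i - l i = diameter (U i)"
    by metis
  have le: "l i \<le> u i" for i
    using lu(2)[of i] U(2) diameter_ge_0[of "U i"] by simp
  show "ennreal (b - a) \<le> (\<Sum>i. ennreal (diameter (U i)))"
  proof (cases "a \<le> b")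
    case True
    have "{a..b} \<subseteq> (\<Union>i. {l i..u i})"
    proof
      fix t assume "t \<in> {a..b}"
      then obtain x where "x \<in> A" "t = f x" using ab by blast
      then obtain i where "x \<in> U i" using U(1) by blast
      then show "t \<in> (\<Union>i. {l i..u i})" using lu(1)[of i] \<open>t = f x\<close> by blast
    qed
    then have "emeasure lborel {a..b} \<le> emeasure lborel (\<Union>i. {l i..u i})"
      by (intro emeasure_mono) auto
    also have "\<dots> \<le> (\<Sum>i. emeasure lborel {l i..u i})"
      by (rule emeasure_subadditive_countably) auto
    also have "\<dots> = (\<Sum>i. ennreal (diameter (U i)))"
      using le lu(2) by simp
    finally show ?thesis using True by simp
  qed (simp add: ennreal_neg)
qed

text \<open>The constant 1 comes from cutting the interval into equal pieces.  Lengths of segments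
  follow, as they are Lipschitz images of this interval.\<close>

lemma hausdorff1_unit_interval_le: "hausdorff1 {0..1::real} \<le> 1"
proof (rule hausdorff1_leI)
  fix d :: real assume d: "0 < d"
  obtain n :: nat where n: "1 / Suc n < d" using d by (meson nat_approx_posE)
  define U where "U i = (if i < Suc n then {real i / Suc n .. real (Suc i) / Suc n} else {})" for i
  have diam: "diameter (U i) = (if i < Suc n then 1 / Suc n else 0)" for i
  proof -
    have "real (Suc i) / Suc n - real i / Suc n = 1 / Suc n"
      by (simp add: field_simps)
    moreover have "real i / Suc n \<le> real (Suc i) / Suc n"
      by (rule divide_right_mono) auto
    ultimately show ?thesis
      by (simp add: U_def diameter_closed_interval)
  qed
  have "hausdorff1_upto d {0..1::real} \<le> (\<Sum>i. ennreal (diameter (U i)))"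
  proof (rule hausdorff1_upto_le_cover)
    show "{0..1} \<subseteq> (\<Union>i. U i)"
    proof
      fix x :: real assume x: "x \<in> {0..1}"
      show "x \<in> (\<Union>i. U i)"
      proof (cases "x = 1")
        case True
        then show ?thesis by (intro UN_I[of n]) (auto simp: U_def)
      next
        case False
        define i where "i = nat \<lfloor>x * Suc n\<rfloor>"
        have i: "real i \<le> x * Suc n" "x * Suc n < real i + 1"
          using x by (auto simp: i_def)
        have "x * real (Suc n) < 1 * real (Suc n)"
          using x False by (intro mult_strict_right_mono) auto
        with i(1) have "real i < 1 * real (Suc n)" by (rule order.strict_trans1)
        then have "i < Suc n" by simp
        with i show ?thesis
          by (intro UN_I[of i]) (auto simp: U_def field_simps)
      qed
    qed
    show "diameter (U i) \<le> d" for i using n d by (auto simp: diam)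
    show "bounded (U i)" for i by (simp add: U_def)
  qed
  also have "\<dots> = (\<Sum>i<Suc n. ennreal (diameter (U i)))"
    by (rule suminf_finite) (auto simp: diam)
  also have "\<dots> = (\<Sum>i<Suc n. ennreal (1 / Suc n))"
    by (rule sum.cong) (auto simp: diam)
  also have "\<dots> = 1"
    by (simp add: ennreal_of_nat_eq_real_of_nat flip: ennreal_mult' del: of_nat_Suc sum.lessThan_Suc)
  finally show "hausdorff1_upto d {0..1::real} \<le> 1" .
qed

lemma hausdorff1_line_le:
  fixes p v :: "'a::real_normed_vector"
  assumes "l \<le> u"
  shows "hausdorff1 ((\<lambda>t. p + t *\<^sub>R v) ` {l..u}) \<le> ennreal ((u - l) * norm v)"
proof -
  have "(\<lambda>t. p + t *\<^sub>R v) ` {l..u} \<subseteq> (\<lambda>t. (p + l *\<^sub>R v) + (t * (u - l)) *\<^sub>R v) ` {0..1}"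
  proof clarify
    fix t assume t: "t \<in> {l..u}"
    show "p + t *\<^sub>R v \<in> (\<lambda>t. (p + l *\<^sub>R v) + (t * (u - l)) *\<^sub>R v) ` {0..1}"
    proof (rule image_eqI)
      have "l + (t - l) / (u - l) * (u - l) = t"
        using t by auto
      then show "p + t *\<^sub>R v = (p + l *\<^sub>R v) + ((t - l) / (u - l) * (u - l)) *\<^sub>R v"
        by (metis add.assoc scaleR_add_left)
    qed (use t in \<open>auto simp: divide_simps\<close>)
  qed
  then have "hausdorff1 ((\<lambda>t. p + t *\<^sub>R v) ` {l..u})
      \<le> hausdorff1 ((\<lambda>t. (p + l *\<^sub>R v) + (t * (u - l)) *\<^sub>R v) ` {0..1})"
    by (rule hausdorff1_mono)
  also have "\<dots> \<le> ennreal ((u - l) * norm v) * hausdorff1 {0..1::real}"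
  proof (rule hausdorff1_lipschitz_image)
    fix x y :: real
    have "(p + l *\<^sub>R v) + (x * (u - l)) *\<^sub>R v - ((p + l *\<^sub>R v) + (y * (u - l)) *\<^sub>R v)
        = ((u - l) * (x - y)) *\<^sub>R v"
      by (simp add: algebra_simps)
    then show "dist ((p + l *\<^sub>R v) + (x * (u - l)) *\<^sub>R v) ((p + l *\<^sub>R v) + (y * (u - l)) *\<^sub>R v)
        \<le> (u - l) * norm v * dist x y"
      using assms by (simp add: dist_norm abs_mult)
  qed (use assms in simp)
  also have "\<dots> \<le> ennreal ((u - l) * norm v) * 1"
    by (intro mult_left_mono hausdorff1_unit_interval_le) simp
  finally show ?thesis by simp
qed

section \<open>Monotonicity of the perimeter on convex sets\<close>

text \<open>If \<open>a\<close> is an inner normal of \<open>K\<close> at \<open>x\<close>, then the points on the outer normal ray at \<open>x\<close> are projected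
  back to \<open>x\<close>.\<close>

lemma closest_point_minus_normal:
  fixes K :: "'a::euclidean_space set"
  assumes K: "convex K" "closed K" and x: "x \<in> K" and a: "\<And>y. y \<in> K \<Longrightarrow> a \<bullet> x \<le> a \<bullet> y"
    and t: "0 \<le> t"
  shows "x = closest_point K (x - t *\<^sub>R a)"
proof (rule closest_point_unique[OF K x], intro ballI)
  fix z assume z: "z \<in> K"
  have "0 \<le> t * (a \<bullet> (z - x))" using a[OF z] t by (simp add: inner_diff_right)
  moreover have "norm (z - x + t *\<^sub>R a)^2
      = norm (z - x)^2 + 2 * (t * (a \<bullet> (z - x))) + norm (t *\<^sub>R a)^2"
    using dot_norm[of "z - x" "t *\<^sub>R a"] by (simp add: inner_commute)
  ultimately have "norm (t *\<^sub>R a)^2 \<le> norm (z - x + t *\<^sub>R a)^2" by simp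
  then have "norm (t *\<^sub>R a) \<le> norm (z - x + t *\<^sub>R a)"
    by (rule power2_le_imp_le) simp
  moreover have "dist (x - t *\<^sub>R a) x = norm (t *\<^sub>R a)"
    by (simp add: dist_norm)
  moreover have "dist (x - t *\<^sub>R a) z = norm (z - x + t *\<^sub>R a)"
    by (simp add: dist_norm norm_minus_commute algebra_simps)
  ultimately show "dist (x - t *\<^sub>R a) x \<le> dist (x - t *\<^sub>R a) z" by simp
qed

text \<open>The nearest point projection onto \<open>K\<close> is nonexpansive, and it maps the boundary of \<open>M\<close> onto a superset of
  the boundary of \<open>K\<close>: the outer normal ray at a boundary point of \<open>K\<close> has to leave the bounded set \<open>M\<close>.\<close>

lemma hausdorff1_frontier_convex_mono:
  fixes K M :: "'a::euclidean_space set"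
  assumes K: "convex K" "closed K" "interior K \<noteq> {}" and KM: "K \<subseteq> M" and M: "bounded M"
  shows "hausdorff1 (frontier K) \<le> hausdorff1 (frontier M)"
proof -
  have ne: "K \<noteq> {}" using K(3) interior_subset by blast
  have "frontier K \<subseteq> closest_point K ` frontier M"
  proof
    fix x assume x: "x \<in> frontier K"
    have xK: "x \<in> K" using x K(2) frontier_subset_closed by blast
    have xni: "x \<notin> rel_interior K"
      using x K(3) by (simp add: frontier_def rel_interior_nonempty_interior)
    obtain a where a: "a \<noteq> 0" "\<forall>y\<in>K. a \<bullet> x \<le> a \<bullet> y"
      by (rule supporting_hyperplane_rel_boundary[OF K(1) xK xni]) (rule that, auto)
    have proj: "x = closest_point K (x - t *\<^sub>R a)" if t: "0 \<le> t" for t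
      using a(2) t by (intro closest_point_minus_normal[OF K(1,2) xK]) auto
    define S where "S = (\<lambda>t. x - t *\<^sub>R a) ` {0..}"
    have "connected S"
      unfolding S_def by (intro connected_continuous_image continuous_intros) simp
    moreover have "x \<in> S" unfolding S_def by (rule image_eqI[of _ _ 0]) auto
    then have "S \<inter> M \<noteq> {}" using xK KM by blast
    moreover have "S - M \<noteq> {}"
    proof
      assume "S - M = {}"
      obtain R where R: "\<And>y. y \<in> M \<Longrightarrow> norm (y - x) \<le> R"
        using M bounded_any_center[of M x] by (auto simp: dist_norm norm_minus_commute)
      define t where "t = (\<bar>R\<bar> + 1) / norm a"
      have t: "0 \<le> t" "t * norm a = \<bar>R\<bar> + 1" using a(1) by (auto simp: t_def)
      have "x - t *\<^sub>R a \<in> M" using \<open>S - M = {}\<close> t(1) unfolding S_def by auto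
      from R[OF this] show False using t by simp
    qed
    ultimately obtain y where y: "y \<in> S" "y \<in> frontier M"
      using connected_Int_frontier[of S M] by blast
    then show "x \<in> closest_point K ` frontier M"
      using proj unfolding S_def by auto
  qed
  then have "hausdorff1 (frontier K) \<le> hausdorff1 (closest_point K ` frontier M)"
    by (rule hausdorff1_mono)
  also have "\<dots> \<le> ennreal 1 * hausdorff1 (frontier M)"
    using closest_point_lipschitz[OF K(1,2) ne] by (intro hausdorff1_lipschitz_image) auto
  finally show ?thesis by simp
qed

section \<open>The square and the octagons inscribed in it\<close>

lemma W2_eq_cbox: "W2 = cbox (-1) 1"
  by (auto simp: W2_def mem_box_cart)

lemma area_cbox: "area (cbox a b) = measure lborel (cbox a b)"
  by (simp add: area_def measure_completion)

lemma area_W2: "area W2 = 4"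
proof -
  have "measure lborel (cbox (-1) (1::real^2)) = (\<Prod>i\<in>(UNIV::2 set). (1::real^2) $ i - (-1::real^2) $ i)"
    by (intro content_cbox_cart) (simp add: interval_ne_empty_cart)
  also have "\<dots> = 4" by (simp add: UNIV_2)
  finally show ?thesis by (simp add: W2_eq_cbox area_cbox)
qed

lemma compact_W2: "compact W2"
  by (simp add: W2_eq_cbox)

text \<open>The square with its corners \<open>\<plusminus>(1, 1)\<close> and \<open>\<plusminus>(-1, 1)\<close> cut off at distances given by \<open>s\<close> and \<open>t\<close>; no
  corner is lost for \<open>s = t = 1\<close>, and \<open>s = t = 0\<close> leaves the diamond.\<close>

definition octagon :: "real \<Rightarrow> real \<Rightarrow> (real^2) set" where
  "octagon s t = {x. \<bar>x$1\<bar> \<le> 1 \<and> \<bar>x$2\<bar> \<le> 1 \<and> \<bar>x$1 + x$2\<bar> \<le> 1 + s \<and> \<bar>x$2 - x$1\<bar> \<le> 1 + t}"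

lemma octagon_eq_W2: "octagon 1 1 = W2"
  by (auto simp: octagon_def W2_def forall_2)

lemma bounded_octagon: "bounded (octagon s t)"
  using compact_imp_bounded[OF compact_W2]
  by (rule bounded_subset) (auto simp: octagon_def W2_def forall_2)

lemma hausdorff1_Un_le_real:
  assumes "hausdorff1 A \<le> ennreal a" "hausdorff1 B \<le> ennreal b" "0 \<le> a" "0 \<le> b"
  shows "hausdorff1 (A \<union> B) \<le> ennreal (a + b)"
  using order_trans[OF hausdorff1_Un_le add_mono[OF assms(1,2)]] assms(3,4) by simp

text \<open>The sides on the lines \<open>x\<^sub>1 = \<plusminus>1\<close> and \<open>x\<^sub>2 = \<plusminus>1\<close> have length \<open>s + t\<close> each; the two cuts of slope \<open>-1\<close> have
  length \<open>\<surd>2 (1 - s)\<close>, and the two of slope \<open>1\<close> have length \<open>\<surd>2 (1 - t)\<close>.\<close>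

lemma hausdorff1_frontier_octagon_le:
  assumes st: "0 \<le> s" "s \<le> 1" "0 \<le> t" "t \<le> 1"
  shows "hausdorff1 (frontier (octagon s t)) \<le> ennreal (4 * (s + t) + 2 * sqrt 2 * (2 - s - t))"
proof -
  define ray :: "real \<Rightarrow> real \<Rightarrow> real \<Rightarrow> real \<Rightarrow> real \<Rightarrow> real^2"
    where "ray a b c d r = vector [a, b] + r *\<^sub>R vector [c, d]" for a b c d r
  have ray: "ray a b c d ` {l..u} = {x. \<exists>r. l \<le> r \<and> r \<le> u \<and> x$1 = a + r * c \<and> x$2 = b + r * d}"
    for a b c d l u
    by (auto simp: ray_def vec_eq_iff forall_2 image_iff)
  define A where "A = ray 1 0 0 1 ` {-t..s} \<union> ray (-1) 0 0 1 ` {-s..t}"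
  define B where "B = ray 0 1 1 0 ` {-t..s} \<union> ray 0 (-1) 1 0 ` {-s..t}"
  define C where "C = ray 0 (1 + s) 1 (-1) ` {s..1} \<union> ray 0 (- 1 - s) 1 (-1) ` {-1..-s}"
  define D where "D = ray 0 (1 + t) 1 1 ` {-1..-t} \<union> ray 0 (- 1 - t) 1 1 ` {t..1}"
  note defs = A_def B_def C_def D_def
  let ?O = "octagon s t"
  have "closed ?O"
    unfolding octagon_def by (intro closed_Collect_conj closed_Collect_le continuous_intros)
  define I where "I = {x::real^2. \<bar>x$1\<bar> < 1 \<and> \<bar>x$2\<bar> < 1 \<and> \<bar>x$1 + x$2\<bar> < 1 + s \<and> \<bar>x$2 - x$1\<bar> < 1 + t}"
  have "open I"
    unfolding I_def by (intro open_Collect_conj open_Collect_less continuous_intros)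
  moreover have "I \<subseteq> ?O" by (auto simp: I_def octagon_def)
  ultimately have "I \<subseteq> interior ?O" by (rule interior_maximal[rotated])
  then have "frontier ?O \<subseteq> ?O - I"
    using \<open>closed ?O\<close> by (auto simp: frontier_def)
  also have "\<dots> \<subseteq> A \<union> B \<union> C \<union> D"
  proof
    fix x assume x: "x \<in> ?O - I"
    then consider "x$1 = 1" | "x$1 = -1" | "x$2 = 1" | "x$2 = -1" | "x$1 + x$2 = 1 + s"
      | "x$1 + x$2 = - 1 - s" | "x$2 - x$1 = 1 + t" | "x$2 - x$1 = - 1 - t"
      unfolding octagon_def I_def by (smt (verit) Diff_iff mem_Collect_eq)
    then show "x \<in> A \<union> B \<union> C \<union> D"
      using x unfolding defs octagon_def ray by cases (auto simp: abs_le_iff algebra_simps)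
  qed
  finally have "hausdorff1 (frontier ?O) \<le> hausdorff1 (A \<union> B \<union> C \<union> D)"
    by (rule hausdorff1_mono)
  also have "\<dots> \<le> ennreal (2 * (s + t) + 2 * (s + t) + 2 * sqrt 2 * (1 - s) + 2 * sqrt 2 * (1 - t))"
  proof -
    have side: "hausdorff1 (ray a b c d ` {l..u}) \<le> ennreal ((u - l) * sqrt (c^2 + d^2))"
      if "l \<le> u" for a b c d l u
      using hausdorff1_line_le[OF that, of "vector [a, b] :: real^2" "vector [c, d]"]
      unfolding ray_def by (simp add: norm_vec_def L2_set_def sum_2)
    have two: "hausdorff1 (ray a b c d ` {l..u} \<union> ray a' b' c d ` {l'..u'}) \<le> ennreal (2 * m * sqrt (c^2 + d^2))"
      if "l \<le> u" "l' \<le> u'" "u - l = m" "u' - l' = m" for a b c d l u a' b' l' u' m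
      using hausdorff1_Un_le_real[OF side[OF that(1), of a b c d] side[OF that(2), of a' b' c d]] that
      by (simp add: mult.assoc)
    have "hausdorff1 A \<le> ennreal (2 * (s + t))" "hausdorff1 B \<le> ennreal (2 * (s + t))"
      "hausdorff1 C \<le> ennreal (2 * sqrt 2 * (1 - s))" "hausdorff1 D \<le> ennreal (2 * sqrt 2 * (1 - t))"
      unfolding defs using st
      by (auto intro!: order_trans[OF two] simp: algebra_simps)
    then show ?thesis
      using st by (intro hausdorff1_Un_le_real) auto
  qed
  also have "2 * (s + t) + 2 * (s + t) + 2 * sqrt 2 * (1 - s) + 2 * sqrt 2 * (1 - t)
      = 4 * (s + t) + 2 * sqrt 2 * (2 - s - t)"
    by (simp add: algebra_simps)
  finally show ?thesis .
qed

text \<open>For the lower bound the sides are shortened by \<open>e\<close> at both ends.  This makes them pairwise separated,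
  so at mesh \<open>e / 2\<close> their lengths add up to \<open>8 - 8 e\<close>.  The upper bound is the case \<open>s = t = 1\<close> of the
  octagon; it also shows that the measure is finite, so that its value as a real number is meaningful.\<close>

lemma perimeter_W2: "perimeter W2 = 8"
proof -
  have le: "hausdorff1 (frontier W2) \<le> ennreal 8"
    using hausdorff1_frontier_octagon_le[of 1 1] by (simp add: octagon_eq_W2)
  have frontier: "frontier W2 = {x. \<bar>x$1\<bar> \<le> 1 \<and> \<bar>x$2\<bar> \<le> 1 \<and> (\<bar>x$1\<bar> = 1 \<or> \<bar>x$2\<bar> = 1)}"
    by (auto simp: W2_eq_cbox frontier_def interior_cbox mem_box_cart forall_2)
  have comp: "\<bar>x$i - y$i\<bar> \<le> dist x y" for x y :: "real^2" and i
    using component_le_norm_cart[of "x - y" i] by (simp add: dist_norm)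
  have ge: "ennreal (8 - 8 * e) \<le> hausdorff1 (frontier W2)" if e: "0 < e" "e < 1" for e
  proof -
    define d where "d = e / 2"
    define side where "side i c = {x::real^2. x$i = c \<and> (\<forall>j. j \<noteq> i \<longrightarrow> \<bar>x$j\<bar> \<le> 1 - e)}" for i and c :: real
    let ?h = "hausdorff1_upto d"
    have *: "ennreal (2 - 2 * e) \<le> ?h (side i c)" if ij: "i \<noteq> j" for i j :: 2 and c
    proof -
      have "{-(1 - e)..1 - e} \<subseteq> (\<lambda>x. x $ j) ` side i c"
      proof
        fix r assume "r \<in> {-(1 - e)..1 - e}"
        then show "r \<in> (\<lambda>x. x $ j) ` side i c"
          using ij exhaust_2 by (intro image_eqI[of _ _ "\<chi> k. if k = i then c else r"]) (auto simp: side_def)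
      qed
      then have "ennreal ((1 - e) - - (1 - e)) \<le> ?h (side i c)"
        using comp by (intro hausdorff1_upto_ge_projection[of "\<lambda>x. x $ j"]) (auto simp: dist_real_def)
      then show ?thesis by (simp add: algebra_simps)
    qed
    have **: "ennreal (2 - 2 * e) \<le> ?h (side i c)" for i c
      using *[of 1 2] *[of 2 1] exhaust_2[of i] by auto
    have sep: "d < dist x y" if "x \<in> side 1 c" "y \<in> side 2 c'" "\<bar>c\<bar> = 1" "\<bar>c'\<bar> = 1" for x y c c'
    proof -
      have "x$1 = c" "\<bar>y$1\<bar> \<le> 1 - e" using that by (auto simp: side_def)
      then show ?thesis using comp[of x 1 y] that(3) e by (auto simp: d_def)
    qed
    have opp: "d < dist x y" if "x \<in> side i 1" "y \<in> side i (-1)" for x y i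
      using comp[of x i y] that e by (auto simp: side_def d_def)
    have "ennreal (8 - 8 * e) = (ennreal (2 - 2 * e) + ennreal (2 - 2 * e)) + (ennreal (2 - 2 * e) + ennreal (2 - 2 * e))"
      using e by (simp flip: ennreal_plus)
    also have "\<dots> \<le> (?h (side 1 1) + ?h (side 1 (-1))) + (?h (side 2 1) + ?h (side 2 (-1)))"
      by (intro add_mono **)
    also have "\<dots> \<le> ?h (side 1 1 \<union> side 1 (-1)) + ?h (side 2 1 \<union> side 2 (-1))"
      by (intro add_mono hausdorff1_upto_Un_separated opp)
    also have "\<dots> \<le> ?h ((side 1 1 \<union> side 1 (-1)) \<union> (side 2 1 \<union> side 2 (-1)))"
      by (intro hausdorff1_upto_Un_separated) (auto intro: sep)
    also have "\<dots> \<le> ?h (frontier W2)"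
      using e by (intro hausdorff1_upto_mono) (auto simp: frontier side_def forall_2)
    also have "\<dots> \<le> hausdorff1 (frontier W2)"
      using e by (intro hausdorff1_upto_le_hausdorff1) (simp add: d_def)
    finally show ?thesis .
  qed
  obtain r where r: "hausdorff1 (frontier W2) = ennreal r" "0 \<le> r" "r \<le> 8"
    using le by (cases "hausdorff1 (frontier W2)") (auto simp: top_unique ennreal_le_iff simp flip: ennreal_numeral)
  have "8 \<le> r"
  proof (rule field_le_epsilon)
    fix e :: real assume e: "0 < e"
    define e' where "e' = min (1/2) (e / 8)"
    have e': "0 < e'" "e' < 1" "8 * e' \<le> e" using e by (auto simp: e'_def)
    show "8 \<le> r + e" using ge[OF e'(1,2)] r e' by simp
  qed
  then show ?thesis using r by (simp add: perimeter_def)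
qed

section \<open>Linear images and parallelograms in the plane\<close>

definition frame :: "real^2 \<Rightarrow> real^2 \<Rightarrow> real^2^2" where
  "frame u v = (\<chi> i j. if j = 1 then u$i else v$i)"

lemma frame_mult: "frame u v *v x = x$1 *\<^sub>R u + x$2 *\<^sub>R v"
  by (simp add: frame_def matrix_vector_mult_def vec_eq_iff sum_2 mult.commute)

lemma det_frame: "det (frame u v) = u$1 * v$2 - v$1 * u$2"
  by (simp add: det_2 frame_def)

lemma area_matrix_image:
  assumes "S \<in> lmeasurable"
  shows "area ((*v) A ` S) = \<bar>det A\<bar> * area S"
  using measure_linear_image[OF matrix_vector_mul_linear assms, of A]
  by (simp add: area_def)

lemma unit_square_convex_hull:
  "cbox (0::real^2) 1 = convex hull {0, axis 1 1, 1, axis 2 1}"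
proof -
  have "{x::real^2. \<forall>i. x$i = 0 \<or> x$i = 1} = {0, axis 1 1, 1, axis 2 1}"
    by (auto simp: vec_eq_iff forall_2 axis_def)
  moreover have "cbox (0::real^2) 1 = convex hull {x. \<forall>i. x$i = 0 \<or> x$i = 1}"
    unfolding Cart_1 unit_interval_convex_hull by (simp add: Basis_vec_def inner_axis)
  ultimately show ?thesis by simp
qed

lemma parallelogram_eq_image:
  "convex hull {a, a + u, a + u + v, a + v} = (+) a ` (*v) (frame u v) ` cbox 0 1"
proof -
  have "{a, a + u, a + u + v, a + v} = (+) a ` (*v) (frame u v) ` {0, axis 1 1, 1, axis 2 1}"
    by (simp add: frame_mult axis_def add.assoc)
  then show ?thesis
    by (simp add: unit_square_convex_hull convex_hull_translation convex_hull_linear_image del: image_insert)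
qed

lemma area_parallelogram:
  "area (convex hull {a, a + u, a + u + v, a + v}) = \<bar>det (frame u v)\<bar>"
proof -
  have "area (cbox (0::real^2) 1) = 1"
    by (simp add: area_cbox content_cbox_cart interval_ne_empty_cart)
  then have "area ((*v) (frame u v) ` cbox 0 1) = \<bar>det (frame u v)\<bar>"
    by (simp add: area_matrix_image)
  then show ?thesis
    unfolding parallelogram_eq_image by (simp add: area_def measure_translation)
qed

lemma area_scaleR_image:
  assumes "S \<in> lmeasurable"
  shows "area ((*\<^sub>R) c ` S) = c\<^sup>2 * area S"
proof -
  let ?M = "frame (c *\<^sub>R axis 1 1) (c *\<^sub>R axis 2 1)"
  have "?M *v x = c *\<^sub>R x" for x
    by (simp add: frame_mult vec_eq_iff forall_2 axis_def)
  then have "(*\<^sub>R) c = (*v) ?M" by auto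
  moreover have "det ?M = c\<^sup>2"
    by (simp add: det_frame axis_def power2_eq_square)
  ultimately show ?thesis
    using area_matrix_image[OF assms, of ?M] by simp
qed

lemma area_triangle:
  "area (convex hull {a, b, c})
    = \<bar>(c$1 - a$1) * (b$2 - a$2) - (b$1 - a$1) * (c$2 - a$2)\<bar> / 2"
proof -
  have "convex hull {a, b, c} \<in> sets lborel"
    by (simp add: borel_compact finite_imp_compact_convex_hull)
  then show ?thesis
    by (simp add: area_def measure_completion content_triangle)
qed

lemma negligible_line:
  assumes "a \<noteq> 0 \<or> b \<noteq> (0::real)"
  shows "negligible {x::real^2. a * x$1 + b * x$2 = c}"
proof -
  have "{x::real^2. a * x$1 + b * x$2 = c} = {x. vector [a, b] \<bullet> x = c}"
    by (simp add: inner_vec_def sum_2)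
  moreover have "vector [a, b] \<noteq> (0::real^2)"
    using assms by (auto simp: vec_eq_iff forall_2)
  ultimately show ?thesis by (simp add: negligible_hyperplane)
qed

lemma area_Un_negligible_Int:
  assumes "A \<in> lmeasurable" "B \<in> lmeasurable" "negligible (A \<inter> B)"
  shows "area (A \<union> B) = area A + area B"
  unfolding area_def using measure_Un3[OF assms(1,2)] negligible_imp_measure0[OF assms(3)] by linarith

lemma area_mono:
  assumes "A \<subseteq> B" "A \<in> lmeasurable" "B \<in> lmeasurable"
  shows "area A \<le> area B"
  unfolding area_def using assms by (intro measure_mono_fmeasurable fmeasurableD)

section \<open>The inscribed diamond\<close>

definition diamond :: "(real^2) set" where
  "diamond = {x. \<bar>x$1\<bar> + \<bar>x$2\<bar> \<le> 1}"

definition diamond_matrix :: "real^2^2" where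
  "diamond_matrix = frame (vector [1/2, 1/2]) (vector [-1/2, 1/2])"

lemma det_diamond_matrix: "det diamond_matrix = 1 / 2"
  by (simp add: diamond_matrix_def det_frame)

lemma diamond_eq_image: "diamond = (*v) diamond_matrix ` W2"
proof (intro equalityI subsetI)
  fix x assume "x \<in> diamond"
  then have "vector [x$1 + x$2, x$2 - x$1] \<in> W2"
    by (auto simp: diamond_def W2_def forall_2)
  moreover have "x = diamond_matrix *v vector [x$1 + x$2, x$2 - x$1]"
    by (auto simp: diamond_matrix_def frame_mult vec_eq_iff forall_2 field_simps)
  ultimately show "x \<in> (*v) diamond_matrix ` W2" by blast
next
  fix x assume "x \<in> (*v) diamond_matrix ` W2"
  then obtain y where "y \<in> W2" "x = diamond_matrix *v y" by blast
  then show "x \<in> diamond"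
    by (auto simp: diamond_def W2_def forall_2 diamond_matrix_def frame_mult abs_if)
qed

lemma compact_matrix_image:
  fixes A :: "real^'n^'m"
  shows "compact S \<Longrightarrow> compact ((*v) A ` S)"
  by (intro compact_continuous_image linear_continuous_on matrix_vector_mul_bounded_linear)

lemma lmeasurable_diamond: "diamond \<in> lmeasurable"
  unfolding diamond_eq_image
  by (intro lmeasurable_compact compact_matrix_image compact_W2)

lemma area_diamond: "area diamond = 2"
  unfolding diamond_eq_image
  by (simp add: area_matrix_image lmeasurable_compact compact_W2 det_diamond_matrix area_W2)

lemma diamond_subset_convex:
  assumes K: "convex K" and sym: "\<And>x. x \<in> K \<Longrightarrow> - x \<in> K" and ax: "axis 1 1 \<in> K" "axis 2 1 \<in> K"
  shows "diamond \<subseteq> K"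
proof
  fix x assume x: "x \<in> diamond"
  have 0: "0 \<in> K"
    using convexD[OF K ax(1) sym[OF ax(1)], of "1/2" "1/2"] by simp
  have pm: "sgn (x$i) *\<^sub>R axis i 1 \<in> K" for i
    using exhaust_2[of i] ax sym 0 by (auto simp: sgn_if)
  let ?P = "{sgn (x$1) *\<^sub>R axis 1 1, sgn (x$2) *\<^sub>R axis 2 1, 0}"
  have "x = \<bar>x$1\<bar> *\<^sub>R (sgn (x$1) *\<^sub>R axis 1 1) + \<bar>x$2\<bar> *\<^sub>R (sgn (x$2) *\<^sub>R axis 2 1) + (1 - \<bar>x$1\<bar> - \<bar>x$2\<bar>) *\<^sub>R 0"
    by (simp add: vec_eq_iff forall_2 axis_def abs_mult_sgn)
  also have "\<dots> \<in> convex hull ?P"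
    using x unfolding convex_hull_3 diamond_def by fastforce
  also have "convex hull ?P \<subseteq> K"
    using pm 0 K by (intro hull_minimal) auto
  finally show "x \<in> K" .
qed

section \<open>Bodies on which the determinant is at most one\<close>

lemma convex_hull_linear_ge:
  fixes S :: "(real^2) set"
  assumes "\<And>z. z \<in> S \<Longrightarrow> l \<le> a * z$1 + b * z$2" "w \<in> convex hull S"
  shows "l \<le> a * w$1 + b * (w$2 :: real)"
proof -
  let ?H = "{z::real^2. vector [a, b] \<bullet> z \<ge> l}"
  have "convex hull S \<subseteq> ?H"
    using assms(1) by (intro hull_minimal convex_halfspace_ge) (auto simp: inner_vec_def sum_2)
  then show ?thesis
    using assms(2) by (auto simp: inner_vec_def sum_2)
qed

text \<open>The triangles over the sides of the diamond with apices \<open>\<plusminus>x\<close> and \<open>\<plusminus>y\<close> have areas \<open>s / 2\<close> and \<open>t / 2\<close>.  Each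
  of them stays in the closed quadrant of its apex and beyond the side on which it stands, so the five
  pieces overlap only in lines.\<close>

lemma area_ge_diamond_plus_caps:
  fixes K :: "(real^2) set"
  assumes K: "convex K" "compact K" and sym: "\<And>x. x \<in> K \<Longrightarrow> - x \<in> K"
    and ax: "axis 1 1 \<in> K" "axis 2 1 \<in> K"
    and x: "x \<in> K" "0 \<le> x$1" "0 \<le> x$2" "x$1 + x$2 = 1 + s" "0 \<le> s"
    and y: "y \<in> K" "y$1 \<le> 0" "0 \<le> y$2" "y$2 - y$1 = 1 + t" "0 \<le> t"
  shows "2 + s + t \<le> area K"
proof -
  define T where "T a z b = convex hull {a, z, b :: real^2}" for a z b
  define A where "A = T (axis 1 1) x (axis 2 1)"
  define A' where "A' = T (- axis 1 1) (- x) (- axis 2 1)"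
  define B where "B = T (axis 2 1) y (- axis 1 1)"
  define B' where "B' = T (- axis 2 1) (- y) (axis 1 1)"
  note defs = A_def A'_def B_def B'_def T_def
  have meas: "T a z b \<in> lmeasurable" for a z b
    unfolding T_def by (intro lmeasurable_compact finite_imp_compact_convex_hull) simp
  have hull: "l \<le> c * w$1 + d * w$2"
    if "w \<in> T a z b" "l \<le> c * a$1 + d * a$2" "l \<le> c * z$1 + d * z$2" "l \<le> c * b$1 + d * b$2"
    for a z b w :: "real^2" and c d l :: real
  proof (rule convex_hull_linear_ge)
    show "w \<in> convex hull {a, z, b}" using that(1) by (simp add: T_def)
  qed (use that(2-4) in auto)
  have A: "0 \<le> z$1" "0 \<le> z$2" "1 \<le> z$1 + z$2" if "z \<in> A" for z
    using hull[OF that[unfolded A_def], of 0 1 0] hull[OF that[unfolded A_def], of 0 0 1]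
      hull[OF that[unfolded A_def], of 1 1 1] x by (auto simp: axis_def)
  have A': "z$1 \<le> 0" "z$2 \<le> 0" "z$1 + z$2 \<le> - 1" if "z \<in> A'" for z
    using hull[OF that[unfolded A'_def], of 0 "-1" 0] hull[OF that[unfolded A'_def], of 0 0 "-1"]
      hull[OF that[unfolded A'_def], of 1 "-1" "-1"] x by (auto simp: axis_def)
  have B: "z$1 \<le> 0" "0 \<le> z$2" "1 \<le> z$2 - z$1" if "z \<in> B" for z
    using hull[OF that[unfolded B_def], of 0 "-1" 0] hull[OF that[unfolded B_def], of 0 0 1]
      hull[OF that[unfolded B_def], of 1 "-1" 1] y by (auto simp: axis_def)
  have B': "0 \<le> z$1" "z$2 \<le> 0" "z$2 - z$1 \<le> - 1" if "z \<in> B'" for z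
    using hull[OF that[unfolded B'_def], of 0 1 0] hull[OF that[unfolded B'_def], of 0 0 "-1"]
      hull[OF that[unfolded B'_def], of 1 1 "-1"] y by (auto simp: axis_def)
  have D: "\<bar>z$1 + z$2\<bar> \<le> 1" "\<bar>z$2 - z$1\<bar> \<le> 1" if "z \<in> diamond" for z
    using that by (auto simp: diamond_def)
  define L where "L a b c = {z::real^2. a * z$1 + b * z$2 = c}" for a b c
  let ?L = "L 1 0 0 \<union> L 0 1 0 \<union> L 1 1 1 \<union> L 1 1 (-1) \<union> L (-1) 1 1 \<union> L (-1) 1 (-1)"
  have neg: "negligible (X \<inter> Y)"
    if "X \<inter> Y \<subseteq> ?L" for X Y
    by (rule negligible_subset[OF _ that]) (unfold L_def, intro negligible_Un negligible_line, auto)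
  have "area (diamond \<union> A \<union> A' \<union> B \<union> B') = area diamond + area A + area A' + area B + area B'"
  proof -
    have m: "A \<in> lmeasurable" "A' \<in> lmeasurable" "B \<in> lmeasurable" "B' \<in> lmeasurable"
      unfolding A_def A'_def B_def B'_def by (rule meas)+
    have n1: "negligible (diamond \<inter> A)"
    proof (rule neg, rule)
      fix z assume "z \<in> diamond \<inter> A"
      then show "z \<in> ?L"
        using D[of z] A[of z] by (auto simp: L_def)
    qed
    have n2: "negligible ((diamond \<union> A) \<inter> A')"
    proof (rule neg, rule)
      fix z assume "z \<in> (diamond \<union> A) \<inter> A'"
      then show "z \<in> ?L"
        using D[of z] A[of z] A'[of z] by (auto simp: L_def)
    qed
    have n3: "negligible ((diamond \<union> A \<union> A') \<inter> B)"
    proof (rule neg, rule)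
      fix z assume "z \<in> (diamond \<union> A \<union> A') \<inter> B"
      then show "z \<in> ?L"
        using D[of z] A[of z] A'[of z] B[of z] by (auto simp: L_def)
    qed
    have n4: "negligible ((diamond \<union> A \<union> A' \<union> B) \<inter> B')"
    proof (rule neg, rule)
      fix z assume "z \<in> (diamond \<union> A \<union> A' \<union> B) \<inter> B'"
      then show "z \<in> ?L"
        using D[of z] A[of z] A'[of z] B[of z] B'[of z] by (auto simp: L_def)
    qed
    show ?thesis
      using lmeasurable_diamond m n1 n2 n3 n4 by (simp add: area_Un_negligible_Int fmeasurable.Un)
  qed
  moreover have "area A = s / 2" "area A' = s / 2" "area B = t / 2" "area B' = t / 2"
    unfolding defs area_triangle using x y by (auto simp: axis_def abs_if field_simps)
  moreover have "area (diamond \<union> A \<union> A' \<union> B \<union> B') \<le> area K"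
  proof (rule area_mono)
    have TK: "T a z b \<subseteq> K" if "a \<in> K" "z \<in> K" "b \<in> K" for a z b
      unfolding T_def using that K(1) by (intro hull_minimal) auto
    show "diamond \<union> A \<union> A' \<union> B \<union> B' \<subseteq> K"
      unfolding A_def A'_def B_def B'_def
      using x(1) y(1) ax by (intro Un_least TK sym diamond_subset_convex[OF K(1) sym ax])
    show "diamond \<union> A \<union> A' \<union> B \<union> B' \<in> lmeasurable"
      unfolding A_def A'_def B_def B'_def by (intro fmeasurable.Un lmeasurable_diamond meas)
    show "K \<in> lmeasurable" using K(2) by (rule lmeasurable_compact)
  qed
  ultimately show ?thesis by (simp add: area_diamond)
qed

text \<open>The determinants with the axis vectors are the coordinates, up to sign.  This confines \<open>K\<close> to the
  square, and forces the maximizers of \<open>x\<^sub>1 + x\<^sub>2\<close> and \<open>x\<^sub>2 - x\<^sub>1\<close> into the right quadrants, since both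
  maxima are at least 1.\<close>

lemma octagon_of_unimodular_body:
  fixes K :: "(real^2) set"
  assumes K: "compact K" and sym: "\<And>x. x \<in> K \<Longrightarrow> - x \<in> K"
    and ax: "axis 1 1 \<in> K" "axis 2 1 \<in> K"
    and det: "\<And>x y. x \<in> K \<Longrightarrow> y \<in> K \<Longrightarrow> \<bar>det (frame x y)\<bar> \<le> 1"
  obtains s t x y where "0 \<le> s" "0 \<le> t" "s + t \<le> 1" "K \<subseteq> octagon s t"
    and "x \<in> K" "0 \<le> x$1" "0 \<le> x$2" "x$1 + x$2 = 1 + s"
    and "y \<in> K" "y$1 \<le> 0" "0 \<le> y$2" "y$2 - y$1 = 1 + t"
proof -
  have ne: "K \<noteq> {}" using ax by blast
  have box: "\<bar>z$1\<bar> \<le> 1" "\<bar>z$2\<bar> \<le> 1" if "z \<in> K" for z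
    using det[OF that ax(1)] det[OF that ax(2)] by (auto simp: det_frame axis_def)
  have contx: "continuous_on K (\<lambda>z. z$1 + z$2)" and conty: "continuous_on K (\<lambda>z. z$2 - z$1)"
    by (intro continuous_intros)+
  obtain x where x: "x \<in> K" "\<And>z. z \<in> K \<Longrightarrow> z$1 + z$2 \<le> x$1 + x$2"
    using continuous_attains_sup[OF K ne, of "\<lambda>z. z$1 + z$2", OF contx] by blast
  obtain y where y: "y \<in> K" "\<And>z. z \<in> K \<Longrightarrow> z$2 - z$1 \<le> y$2 - y$1"
    using continuous_attains_sup[OF K ne, of "\<lambda>z. z$2 - z$1", OF conty] by blast
  define s where "s = x$1 + x$2 - 1"
  define t where "t = y$2 - y$1 - 1"
  have s: "0 \<le> s" using x(2)[OF ax(1)] by (simp add: s_def axis_def)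
  have t: "0 \<le> t" using y(2)[OF ax(2)] by (simp add: t_def axis_def)
  have xb: "0 \<le> x$1" "0 \<le> x$2" and yb: "y$1 \<le> 0" "0 \<le> y$2"
    using box[OF x(1)] box[OF y(1)] s t by (auto simp: s_def t_def)
  \<comment> \<open>The difference of the two sides is the sum of two products of nonnegative numbers.\<close>
  have "s + t \<le> x$1 * y$2 - y$1 * x$2"
  proof -
    have "0 \<le> (1 - x$1) * (1 - y$2)" "0 \<le> (1 - x$2) * (1 + y$1)"
      using box[OF x(1)] box[OF y(1)] by auto
    then show ?thesis by (simp add: s_def t_def algebra_simps)
  qed
  also have "\<dots> \<le> 1"
    using det[OF x(1) y(1)] by (simp add: det_frame)
  finally have st: "s + t \<le> 1" .
  have "K \<subseteq> octagon s t"
  proof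
    fix z assume z: "z \<in> K"
    show "z \<in> octagon s t"
      using box[OF z] x(2)[OF z] x(2)[OF sym[OF z]] y(2)[OF z] y(2)[OF sym[OF z]]
      by (auto simp: octagon_def s_def t_def abs_le_iff)
  qed
  with s t st xb yb x(1) y(1) show thesis
    by (intro that[of s t x y]) (auto simp: s_def t_def)
qed

lemma normalized_body_estimates:
  fixes K :: "(real^2) set"
  assumes K: "convex K" "compact K" "interior K \<noteq> {}" and sym: "\<And>x. x \<in> K \<Longrightarrow> - x \<in> K"
    and ax: "axis 1 1 \<in> K" "axis 2 1 \<in> K"
    and det: "\<And>x y. x \<in> K \<Longrightarrow> y \<in> K \<Longrightarrow> \<bar>det (frame x y)\<bar> \<le> 1"
  obtains \<sigma> where "0 \<le> \<sigma>" "\<sigma> \<le> 1" "2 + \<sigma> \<le> area K" "K \<subseteq> (*\<^sub>R) (1 + \<sigma>) ` diamond"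
    and "hausdorff1 (frontier K) \<le> ennreal (4 * sqrt 2 + (4 - 2 * sqrt 2) * \<sigma>)"
proof -
  obtain s t x y where st: "0 \<le> s" "0 \<le> t" "s + t \<le> 1" and oct: "K \<subseteq> octagon s t"
    and x: "x \<in> K" "0 \<le> x$1" "0 \<le> x$2" "x$1 + x$2 = 1 + s"
    and y: "y \<in> K" "y$1 \<le> 0" "0 \<le> y$2" "y$2 - y$1 = 1 + t"
    using octagon_of_unimodular_body[OF K(2) sym ax det] by metis
  show thesis
  proof (rule that[of "s + t"])
    show "2 + (s + t) \<le> area K"
      using area_ge_diamond_plus_caps[OF K(1,2) sym ax x st(1) y st(2)] by (simp add: add.assoc)
    show "K \<subseteq> (*\<^sub>R) (1 + (s + t)) ` diamond"
    proof
      fix z assume "z \<in> K"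
      then have "\<bar>z$1 + z$2\<bar> \<le> 1 + s" "\<bar>z$2 - z$1\<bar> \<le> 1 + t"
        using oct by (auto simp: octagon_def)
      then have "\<bar>z$1\<bar> + \<bar>z$2\<bar> \<le> 1 + (s + t)" using st by linarith
      then have "(1 / (1 + (s + t))) *\<^sub>R z \<in> diamond"
        using st by (simp add: diamond_def abs_mult flip: add_divide_distrib)
      then show "z \<in> (*\<^sub>R) (1 + (s + t)) ` diamond"
        using st by (intro image_eqI) auto
    qed
    have "hausdorff1 (frontier K) \<le> hausdorff1 (frontier (octagon s t))"
      using K by (intro hausdorff1_frontier_convex_mono oct bounded_octagon) (auto simp: compact_imp_closed)
    also have "\<dots> \<le> ennreal (4 * (s + t) + 2 * sqrt 2 * (2 - s - t))"
      using st by (intro hausdorff1_frontier_octagon_le) auto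
    also have "4 * (s + t) + 2 * sqrt 2 * (2 - s - t) = 4 * sqrt 2 + (4 - 2 * sqrt 2) * (s + t)"
      by (simp add: algebra_simps)
    finally show "hausdorff1 (frontier K) \<le> ennreal (4 * sqrt 2 + (4 - 2 * sqrt 2) * (s + t))" .
  qed (use st in auto)
qed

section \<open>Upper bounds for the two distances\<close>

text \<open>In the definition of the distance the image of the square is the middle set of the chain, so the
  matrix to use is \<open>c A\<close> rather than \<open>A\<close>.\<close>

lemma delta_BM_le:
  fixes A :: "real^2^2"
  assumes A: "invertible A" "(*v) A ` W2 \<subseteq> K" "K \<subseteq> (*\<^sub>R) c ` (*v) A ` W2" and c: "1 \<le> c"
  shows "delta_BM K W2 \<le> ln c"
proof -
  let ?S = "{c. 1 \<le> c \<and> (\<exists>\<Phi>::real^2^2. invertible \<Phi> \<and> K \<subseteq> (*v) \<Phi> ` W2 \<and> (*v) \<Phi> ` W2 \<subseteq> (*\<^sub>R) c ` K)}"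
  have eq: "(*v) (c *\<^sub>R A) ` W2 = (*\<^sub>R) c ` (*v) A ` W2"
    by (simp add: image_image scaleR_matrix_vector_assoc)
  have "det (c *\<^sub>R A) = c^2 * det A"
    by (simp add: det_2 power2_eq_square algebra_simps)
  then have "invertible (c *\<^sub>R A)"
    using A(1) c by (simp add: invertible_det_nz)
  moreover have "K \<subseteq> (*v) (c *\<^sub>R A) ` W2" "(*v) (c *\<^sub>R A) ` W2 \<subseteq> (*\<^sub>R) c ` K"
    unfolding eq using A(2,3) by (auto intro: image_mono)
  ultimately have mem: "c \<in> ?S" using c by blast
  then have "Inf ?S \<le> c"
    by (rule cInf_lower) (auto intro: bdd_belowI[of _ 1])
  moreover have "1 \<le> Inf ?S"
    using mem by (intro cInf_greatest) auto
  ultimately show ?thesis by (simp add: delta_BM_def)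
qed

lemma powr_minus_half: "0 < x \<Longrightarrow> x powr (- 1 / 2) = 1 / sqrt x"
  using powr_minus_divide[of x "1/2"] by (simp add: powr_half_sqrt)

text \<open>A multiple of the inverse of \<open>A\<close> has determinant 1 and turns the inclusion of \<open>A W\<close> in \<open>K\<close> into the
  inclusion of a small square \<open>C\<close> in the normalized image \<open>X\<close> of \<open>K\<close>.  The normalized square \<open>Y\<close> contains
  \<open>C\<close> too, since \<open>A W\<close> is no larger than \<open>K\<close>.  As \<open>X\<close> and \<open>Y\<close> have area 1, their symmetric difference
  has area at most \<open>2 (1 - area C)\<close>.\<close>

lemma delta_vol_le:
  fixes A :: "real^2^2"
  assumes A: "0 < det A" "(*v) A ` W2 \<subseteq> K" and K: "compact K"
  shows "delta_vol K W2 \<le> 2 * (1 - area ((*v) A ` W2) / area K)"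
proof -
  have W: "W2 \<in> lmeasurable" by (simp add: lmeasurable_compact compact_W2)
  have areaA: "area ((*v) A ` W2) = 4 * det A"
    using A(1) by (simp add: area_matrix_image[OF W] area_W2)
  have "area ((*v) A ` W2) \<le> area K"
    using A(2) K by (intro area_mono lmeasurable_compact compact_matrix_image compact_W2) auto
  then have V: "0 < area K" "4 * det A \<le> area K" using A(1) areaA by auto
  define \<alpha> where "\<alpha> = area K powr (- 1 / 2)"
  define \<beta> where "\<beta> = area W2 powr (- 1 / 2)"
  have \<alpha>: "0 < \<alpha>" "\<alpha>\<^sup>2 = 1 / area K"
    unfolding \<alpha>_def powr_minus_half[OF V(1)] using V by (auto simp: power_divide)
  have \<beta>: "\<beta> = 1 / 2"
    unfolding \<beta>_def area_W2 by (subst powr_minus_half) auto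
  obtain A' where invA: "A ** A' = mat 1" "A' ** A = mat 1"
    using A(1) invertible_det_nz[of A] unfolding invertible_def by auto
  define \<Phi> where "\<Phi> = sqrt (det A) *\<^sub>R A'"
  have "det A * det (A') = 1"
    using invA(1) by (metis det_I det_mul)
  moreover have "det \<Phi> = (sqrt (det A))\<^sup>2 * det (A')"
    by (simp add: \<Phi>_def det_2 power2_eq_square algebra_simps)
  ultimately have det\<Phi>: "det \<Phi> = 1" using A(1) by simp
  have \<Phi>A: "\<Phi> *v (A *v x) = sqrt (det A) *\<^sub>R x" for x
  proof -
    have "A' *v (A *v x) = x" by (simp add: matrix_vector_mul_assoc invA)
    then show ?thesis by (simp add: \<Phi>_def flip: scaleR_matrix_vector_assoc)
  qed
  define X where "X = (*v) \<Phi> ` (*\<^sub>R) \<alpha> ` K"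
  define Y where "Y = (*\<^sub>R) \<beta> ` W2"
  define \<gamma> where "\<gamma> = \<alpha> * sqrt (det A)"
  define C where "C = (*\<^sub>R) \<gamma> ` W2"
  have meas: "X \<in> lmeasurable" "Y \<in> lmeasurable" "C \<in> lmeasurable"
    unfolding X_def Y_def C_def
    by (auto intro!: lmeasurable_compact compact_matrix_image compact_scaling compact_W2 K)
  have "area X = \<bar>det \<Phi>\<bar> * (\<alpha>\<^sup>2 * area K)"
    unfolding X_def using K
    by (simp add: area_matrix_image area_scaleR_image lmeasurable_compact compact_scaling)
  then have X: "area X = 1" using V by (simp add: det\<Phi> \<alpha>)
  have Y: "area Y = 1"
    by (simp add: Y_def area_scaleR_image[OF W] area_W2 \<beta> power2_eq_square)
  have \<gamma>2: "\<gamma>\<^sup>2 = det A / area K"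
    using A(1) by (simp add: \<gamma>_def power_mult_distrib \<alpha>)
  have areaC: "area C = area ((*v) A ` W2) / area K"
    by (simp add: C_def area_scaleR_image[OF W] area_W2 areaA \<gamma>2)
  have CX: "C \<subseteq> X"
  proof
    fix z assume "z \<in> C"
    then obtain w where w: "w \<in> W2" "z = \<gamma> *\<^sub>R w" by (auto simp: C_def)
    then have "z = \<Phi> *v (\<alpha> *\<^sub>R (A *v w))"
      by (simp add: matrix_vector_mult_scaleR \<Phi>A \<gamma>_def)
    then show "z \<in> X" using A(2) w(1) unfolding X_def by blast
  qed
  have "\<gamma>\<^sup>2 \<le> (1 / 2)\<^sup>2" unfolding \<gamma>2 using V by (simp add: power2_eq_square divide_le_eq)
  then have \<gamma>: "\<gamma> \<le> 1 / 2" by (rule power2_le_imp_le) simp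
  have \<gamma>0: "0 \<le> \<gamma>" using \<alpha> A(1) by (simp add: \<gamma>_def)
  have CY: "C \<subseteq> Y"
  proof
    fix z assume "z \<in> C"
    then obtain w where w: "w \<in> W2" "z = \<gamma> *\<^sub>R w" by (auto simp: C_def)
    have "(2 * \<gamma>) *\<^sub>R w \<in> W2"
    proof -
      have "\<bar>2 * \<gamma> * w$i\<bar> \<le> 1" for i
      proof -
        have "\<bar>2 * \<gamma>\<bar> * \<bar>w$i\<bar> \<le> 1 * 1"
          using \<gamma> \<gamma>0 w(1) by (intro mult_mono) (auto simp: W2_def abs_le_iff)
        then show ?thesis by (simp add: abs_mult)
      qed
      then show ?thesis by (auto simp: W2_def abs_le_iff)
    qed
    moreover have "z = \<beta> *\<^sub>R ((2 * \<gamma>) *\<^sub>R w)" by (simp add: w \<beta>)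
    ultimately show "z \<in> Y" unfolding Y_def by blast
  qed
  have diff: "area (Z - C) = area Z - area C" if "Z \<in> lmeasurable" "C \<subseteq> Z" for Z
    unfolding area_def using that meas by (intro measurable_measure_Diff) auto
  have "area (sym_diff X Y) \<le> area ((X - C) \<union> (Y - C))"
    using CX CY meas by (intro area_mono) auto
  also have "\<dots> \<le> area (X - C) + area (Y - C)"
    unfolding area_def using meas by (intro measure_Un_le) auto
  also have "\<dots> = 2 * (1 - area ((*v) A ` W2) / area K)"
    using meas CX CY by (simp add: diff X Y areaC)
  finally have le: "area (sym_diff X Y) \<le> 2 * (1 - area ((*v) A ` W2) / area K)" .
  have "delta_vol K W2 \<le> area (sym_diff X Y)"
    unfolding delta_vol_def Let_def X_def Y_def \<alpha>_def \<beta>_def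
    using det\<Phi> by (intro cINF_lower bdd_belowI[of _ 0]) (auto simp: area_def)
  with le show ?thesis by linarith
qed

section \<open>The half diagonals of a square of maximal area\<close>

definition rot90 :: "real^2 \<Rightarrow> real^2" where
  "rot90 p = vector [- p$2, p$1]"

lemma det_frame_rot90: "det (frame p (rot90 p)) = (norm p)\<^sup>2"
  by (simp add: det_frame rot90_def power2_norm_eq_inner inner_vec_def sum_2)

text \<open>Multiplication by the complex number \<open>p\<close>, a similarity of ratio \<open>\<bar>p\<bar>\<close>.\<close>

lemma dist_frame_rot90:
  "dist (frame p (rot90 p) *v x) (frame p (rot90 p) *v y) = norm p * dist x y"
proof -
  have "(norm (frame p (rot90 p) *v z))\<^sup>2 = (norm p * norm z)\<^sup>2" for z
    by (simp add: power_mult_distrib power2_norm_eq_inner inner_vec_def sum_2 frame_mult rot90_def algebra_simps)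
  then have "norm (frame p (rot90 p) *v z) = norm p * norm z" for z
    by (metis mult_nonneg_nonneg norm_ge_zero power2_eq_iff_nonneg)
  then show ?thesis
    by (simp add: dist_norm flip: matrix_vector_mult_diff_distrib)
qed

lemma det_frame_image: "det (frame (A *v x) (A *v y)) = det A * det (frame x y)"
proof -
  have "(A *v z) $ i = A$i$1 * z$1 + A$i$2 * z$2" for z i
    by (simp add: matrix_vector_mult_def sum_2)
  then show ?thesis
    unfolding det_frame det_2[of A] by (simp add: algebra_simps)
qed

text \<open>The competitor is the parallelogram with vertices \<open>\<plusminus>x, \<plusminus>y\<close>, spanned from \<open>-x\<close> by \<open>x + y\<close> and \<open>x - y\<close>.\<close>

lemma det_frame_le_max_parallelogram:
  assumes K: "convex K" "\<And>x. x \<in> K \<Longrightarrow> - x \<in> K" and Q: "max_area_inscribed_parallelogram Q K"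
    and xy: "x \<in> K" "y \<in> K"
  shows "2 * \<bar>det (frame x y)\<bar> \<le> area Q"
proof (cases "det (frame x y) = 0")
  case True
  then show ?thesis by (simp add: area_def)
next
  case False
  let ?P = "convex hull {- x, - x + (x + y), - x + (x + y) + (x - y), - x + (x - y)}"
  have det: "det (frame (x + y) (x - y)) = - 2 * det (frame x y)"
    by (simp add: det_frame algebra_simps)
  have "det (frame u v) = 0" if "collinear {0, u, v}" for u v
    using that by (auto simp: collinear_lemma det_frame)
  then have "\<not> collinear {0, x + y, x - y}" using False det by fastforce
  then have "is_parallelogram ?P" unfolding is_parallelogram_def by blast
  moreover have "?P \<subseteq> K"
    using K xy by (intro hull_minimal) auto
  ultimately have "area ?P \<le> area Q"
    using Q unfolding max_area_inscribed_parallelogram_def by blast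
  then show ?thesis unfolding area_parallelogram det by simp
qed

text \<open>Half the difference of two points of a symmetric convex set lies in the set.  For opposite vertices of
  the square this puts both half diagonals into \<open>K\<close>, wherever the centre of the square is.  They are
  rotations of each other by a right angle, but the sense depends on the orientation of \<open>u\<close> and \<open>v\<close>;
  by symmetry of \<open>K\<close> the second one can be taken to be \<open>rot90 p\<close>.\<close>

lemma max_square_half_diagonal:
  assumes K: "convex K" "\<And>x. x \<in> K \<Longrightarrow> - x \<in> K"
    and Q: "is_square Q" "max_area_inscribed_parallelogram Q K"
  obtains p where "p \<noteq> 0" "p \<in> K" "rot90 p \<in> K"
    "\<And>x y. x \<in> K \<Longrightarrow> y \<in> K \<Longrightarrow> \<bar>det (frame x y)\<bar> \<le> (norm p)\<^sup>2"
proof -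
  obtain a u v where uv: "u \<noteq> 0" "norm u = norm v" "u \<bullet> v = 0"
    and Qeq: "Q = convex hull {a, a + u, a + u + v, a + v}"
    using Q(1) unfolding is_square_def by blast
  have "Q \<subseteq> K" using Q(2) by (simp add: max_area_inscribed_parallelogram_def)
  then have V: "a \<in> K" "a + u \<in> K" "a + u + v \<in> K" "a + v \<in> K"
    unfolding Qeq by (auto intro: hull_inc)
  have half: "(1/2) *\<^sub>R (x - y) \<in> K" if "x \<in> K" "y \<in> K" for x y
    using convexD[OF K(1) that(1) K(2)[OF that(2)], of "1/2" "1/2"] by (simp add: algebra_simps)
  define p where "p = (1/2) *\<^sub>R (u + v)"
  define N where "N = (norm u)\<^sup>2"
  define d where "d = det (frame u v)"
  have N: "N = u$1 * u$1 + u$2 * u$2" "N = v$1 * v$1 + v$2 * v$2" "0 < N"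
  proof -
    show "N = u$1 * u$1 + u$2 * u$2"
      by (simp add: N_def power2_norm_eq_inner inner_vec_def sum_2)
    show "N = v$1 * v$1 + v$2 * v$2"
      by (simp add: N_def uv(2) power2_norm_eq_inner inner_vec_def sum_2)
    show "0 < N" using uv(1) by (simp add: N_def)
  qed
  have orth: "u$1 * v$1 + u$2 * v$2 = 0"
    using uv(3) by (simp add: inner_vec_def sum_2)
  have d: "d = u$1 * v$2 - v$1 * u$2" by (simp add: d_def det_frame)
  have "d\<^sup>2 = N\<^sup>2"
  proof -
    have "d\<^sup>2 + (u$1 * v$1 + u$2 * v$2)\<^sup>2 = (u$1 * u$1 + u$2 * u$2) * (v$1 * v$1 + v$2 * v$2)"
      unfolding d by algebra
    then show ?thesis by (simp add: orth power2_eq_square flip: N(1,2))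
  qed
  then have dN: "d = N \<or> d = - N" by (simp add: power2_eq_iff)
  \<comment> \<open>In an orthogonal frame \<open>v\<close> is a multiple of \<open>rot90 u\<close>, and the factor \<open>d / N\<close> is \<open>\<plusminus>1\<close>.\<close>
  have v: "N * v$1 = - u$2 * d" "N * v$2 = u$1 * d"
    unfolding N(1) d using orth by algebra+
  have N0: "N \<noteq> 0" using N(3) by simp
  have vu: "v = rot90 u \<or> v = - rot90 u"
    using dN
  proof
    assume "d = N"
    then have "N * v$1 = N * (- u$2)" "N * v$2 = N * u$1" using v by simp_all
    then have "v$1 = - u$2" "v$2 = u$1" by (simp_all only: mult_left_cancel[OF N0])
    then show ?thesis by (simp add: vec_eq_iff forall_2 rot90_def)
  next
    assume "d = - N"
    then have "N * v$1 = N * u$2" "N * v$2 = N * (- u$1)" using v by simp_all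
    then have "v$1 = u$2" "v$2 = - u$1" by (simp_all only: mult_left_cancel[OF N0])
    then show ?thesis by (simp add: vec_eq_iff forall_2 rot90_def)
  qed
  have rot: "rot90 p = (1/2) *\<^sub>R (v - u) \<or> rot90 p = (1/2) *\<^sub>R (u - v)"
    using vu
  proof
    assume "v = rot90 u"
    then have "rot90 p = (1/2) *\<^sub>R (v - u)"
      by (simp add: p_def rot90_def vec_eq_iff forall_2 field_simps)
    then show ?thesis ..
  next
    assume "v = - rot90 u"
    then have "rot90 p = (1/2) *\<^sub>R (u - v)"
      by (simp add: p_def rot90_def vec_eq_iff forall_2 field_simps)
    then show ?thesis ..
  qed
  have np: "(norm p)\<^sup>2 = N / 2"
  proof -
    have "(norm p)\<^sup>2 = ((u$1 * u$1 + u$2 * u$2) + (v$1 * v$1 + v$2 * v$2) + 2 * (u$1 * v$1 + u$2 * v$2)) / 4"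
      unfolding power2_norm_eq_inner p_def by (simp add: inner_vec_def sum_2 field_simps)
    then show ?thesis by (simp add: orth flip: N(1,2))
  qed
  have areaQ: "area Q = N"
    unfolding Qeq area_parallelogram d_def[symmetric] using dN N(3) by auto
  show thesis
  proof (rule that[of p])
    show "p \<noteq> 0" using np N(3) by auto
    show "p \<in> K" using half[OF V(3,1)] by (simp add: p_def add.assoc)
    show "rot90 p \<in> K" using rot half[OF V(4,2)] half[OF V(2,4)] by auto
    show "\<bar>det (frame x y)\<bar> \<le> (norm p)\<^sup>2" if "x \<in> K" "y \<in> K" for x y
      using det_frame_le_max_parallelogram[OF K Q(2) that] by (simp add: areaQ np)
  qed
qed

lemma frontier_matrix_image:
  fixes A :: "real^'n^'n"
  assumes "det A \<noteq> 0" "closed S"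
  shows "frontier ((*v) A ` S) = (*v) A ` frontier S"
proof -
  have inj: "inj ((*v) A)"
    using assms(1) by (simp add: inj_matrix_vector_mult invertible_det_nz)
  have "closed ((*v) A ` S)"
    using inj assms(2) by (intro closed_injective_linear_image) auto
  then show ?thesis
    using assms(2) inj
    by (simp add: frontier_def interior_injective_linear_image image_set_diff)
qed

section \<open>The isoperimetric estimate\<close>

text \<open>Here \<open>2 + w\<close> is the area of the body.  The left side is a convex quadratic in \<open>\<sigma>\<close>, so on \<open>[0, 1]\<close> it lies
  below its chord \<open>32 + (16 \<surd>2 - 8) \<sigma>\<close>, of slope less than \<open>366/25\<close>.  The right side is at least
  \<open>32 + (416/27) \<sigma> - (8/27) \<sigma>\<^sup>2\<close> under the first bound on \<open>\<epsilon>\<close>, and at least \<open>32 + (416/27) w\<close> under the second.\<close>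

lemma isoperimetric_inequality_numeric:
  fixes \<sigma> w \<epsilon> :: real
  assumes \<sigma>: "0 \<le> \<sigma>" "\<sigma> \<le> 1" "\<sigma> \<le> w" and \<epsilon>: "\<epsilon> \<le> \<sigma> \<or> \<epsilon> \<le> 2 * (1 - 2 / (2 + w))"
  shows "(4 * sqrt 2 + (4 - 2 * sqrt 2) * \<sigma>)\<^sup>2 \<le> (1 - \<epsilon> / 54) * 16 * (2 + w)"
proof -
  define q where "q = sqrt (2::real)"
  have q: "q * q = 2" "0 \<le> q" by (simp_all add: q_def)
  have "q\<^sup>2 \<le> (283/200)\<^sup>2" by (simp add: q power2_eq_square)
  then have q': "q \<le> (283/200)" by (rule power2_le_imp_le) simp
  have "(4 * q + (4 - 2 * q) * \<sigma>)\<^sup>2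
      = 16 * (q * q) + (32 * q - 16 * (q * q)) * \<sigma> + (16 - 16 * q + 4 * (q * q)) * (\<sigma> * \<sigma>)"
    by algebra
  also have "\<dots> = 32 + (32 * q - 32) * \<sigma> + (24 - 16 * q) * (\<sigma> * \<sigma>)"
    by (simp add: q)
  also have "\<dots> \<le> 32 + (32 * q - 32) * \<sigma> + (24 - 16 * q) * \<sigma>"
  proof -
    have "(24 - 16 * q) * (\<sigma> * \<sigma>) \<le> (24 - 16 * q) * (\<sigma> * 1)"
      using q' \<sigma> by (intro mult_left_mono) auto
    then show ?thesis by simp
  qed
  also have "\<dots> = 32 + (16 * q - 8) * \<sigma>" by (simp add: algebra_simps)
  also have "\<dots> \<le> 32 + (366/25) * \<sigma>"
    using q' \<sigma> by (intro add_left_mono mult_right_mono) auto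
  also have "\<dots> \<le> (1 - \<epsilon> / 54) * 16 * (2 + w)"
    using \<epsilon>
  proof
    assume e: "\<epsilon> \<le> \<sigma>"
    have "32 + (366/25) * \<sigma> \<le> (1 - \<sigma> / 54) * 16 * (2 + \<sigma>)"
    proof -
      have lin: "32 + (366/25) * \<sigma> \<le> 32 + (416/27) * \<sigma> - 8 / 27 * m" if "m \<le> \<sigma>" for m
        using that \<sigma> by linarith
      have "\<sigma> * \<sigma> \<le> \<sigma> * 1" using \<sigma> by (intro mult_left_mono) auto
      then have "32 + (366/25) * \<sigma> \<le> 32 + (416/27) * \<sigma> - 8 / 27 * (\<sigma> * \<sigma>)"
        by (intro lin) simp
      also have "\<dots> = (1 - \<sigma> / 54) * 16 * (2 + \<sigma>)"
        by (simp add: field_simps)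
      finally show ?thesis .
    qed
    also have "\<dots> \<le> (1 - \<epsilon> / 54) * 16 * (2 + w)"
      using e \<sigma> by (intro mult_mono) auto
    finally show ?thesis .
  next
    assume e: "\<epsilon> \<le> 2 * (1 - 2 / (2 + w))"
    have "\<epsilon> * (2 + w) \<le> 2 * (1 - 2 / (2 + w)) * (2 + w)"
      using e \<sigma> by (intro mult_right_mono) auto
    also have "\<dots> = 2 * w" using \<sigma> by (simp add: field_simps)
    finally have bound: "\<epsilon> * (2 + w) \<le> 2 * w" .
    have "32 + (366/25) * \<sigma> \<le> 32 + (416/27) * w"
      using \<sigma> by (intro add_left_mono mult_mono) auto
    also have "\<dots> = 16 * (2 + w) - 8 / 27 * (2 * w)"
      by simp
    also have "\<dots> \<le> 16 * (2 + w) - 8 / 27 * (\<epsilon> * (2 + w))"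
      using bound by (intro diff_left_mono mult_left_mono) auto
    also have "\<dots> = (1 - \<epsilon> / 54) * 16 * (2 + w)"
      by (simp add: field_simps)
    finally show ?thesis .
  qed
  finally show ?thesis by (simp add: q_def)
qed

theorem theorem1p3:
  fixes K :: "(real^2) set" and \<epsilon> :: real
  assumes "convex_body K" and "origin_symmetric K"
    and "\<exists>Q. is_square Q \<and> max_area_inscribed_parallelogram Q K"
    and "\<epsilon> \<in> {0..<1}"
    and "delta_vol K W2 \<ge> \<epsilon> \<or> delta_BM K W2 \<ge> \<epsilon>"
  shows "(perimeter K)\<^sup>2 / area K \<le> (1 - \<epsilon> / 54) * ((perimeter W2)\<^sup>2 / area W2)"
proof -
  have K: "compact K" "convex K" "interior K \<noteq> {}"
    using assms(1) by (auto simp: convex_body_def)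
  have sym: "- x \<in> K" if "x \<in> K" for x
    using assms(2) that by (auto simp: origin_symmetric_def)
  obtain p where p: "p \<noteq> 0" "p \<in> K" "rot90 p \<in> K"
    and pdet: "\<And>x y. x \<in> K \<Longrightarrow> y \<in> K \<Longrightarrow> \<bar>det (frame x y)\<bar> \<le> (norm p)\<^sup>2"
    using max_square_half_diagonal[OF K(2) sym] assms(3) by metis
  define r where "r = norm p"
  have r: "0 < r" using p(1) by (simp add: r_def)
  define T where "T = frame p (rot90 p)"
  have detT: "det T = r\<^sup>2" by (simp add: T_def r_def det_frame_rot90)
  have distT: "dist (T *v x) (T *v y) = r * dist x y" for x y
    by (simp add: T_def r_def dist_frame_rot90)
  have invT: "invertible T" using r by (simp add: invertible_det_nz detT)
  define K' where "K' = (*v) T -` K"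
  have KT: "K = (*v) T ` K'"
  proof -
    obtain T' where "T ** T' = mat 1" using invT unfolding invertible_def by blast
    then have "T *v (T' *v x) = x" for x by (simp add: matrix_vector_mul_assoc)
    then have "surj ((*v) T)" by (metis surjI)
    then show ?thesis by (simp add: K'_def surj_image_vimage_eq)
  qed
  have K': "convex K'" "compact K'" "interior K' \<noteq> {}"
  proof -
    show "convex K'"
      unfolding K'_def using K(2) by (intro convex_linear_vimage) auto
    have "closed K'"
      unfolding K'_def using K(1)
      by (intro closed_vimage compact_imp_closed linear_continuous_on matrix_vector_mul_bounded_linear)
    moreover have "bounded K'"
    proof -
      obtain b where b: "\<And>x. x \<in> K \<Longrightarrow> norm x \<le> b"
        using K(1) compact_imp_bounded bounded_iff by metis
      have "norm x \<le> b / r" if "x \<in> K'" for x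
      proof -
        have "r * norm x \<le> b" using b[of "T *v x"] that distT[of x 0] by (simp add: K'_def)
        then show ?thesis using r by (simp add: field_simps)
      qed
      then show ?thesis unfolding bounded_iff by blast
    qed
    ultimately show "compact K'" by (simp add: compact_eq_bounded_closed)
    have "interior K = (*v) T ` interior K'"
      unfolding KT using invT by (intro interior_injective_linear_image) (auto simp: inj_matrix_vector_mult)
    with K(3) show "interior K' \<noteq> {}" by auto
  qed
  have sym': "- x \<in> K'" if "x \<in> K'" for x
    using sym[of "T *v x"] that by (simp add: K'_def linear_neg[OF matrix_vector_mul_linear])
  have ax: "axis 1 1 \<in> K'" "axis 2 1 \<in> K'"
    using p by (auto simp: K'_def T_def frame_mult axis_def)
  have det': "\<bar>det (frame x y)\<bar> \<le> 1" if "x \<in> K'" "y \<in> K'" for x y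
    using pdet[of "T *v x" "T *v y"] that r
    by (simp add: K'_def det_frame_image detT abs_mult flip: r_def)
  obtain \<sigma> where \<sigma>: "0 \<le> \<sigma>" "\<sigma> \<le> 1" "2 + \<sigma> \<le> area K'" "K' \<subseteq> (*\<^sub>R) (1 + \<sigma>) ` diamond"
    and len: "hausdorff1 (frontier K') \<le> ennreal (4 * sqrt 2 + (4 - 2 * sqrt 2) * \<sigma>)"
    using normalized_body_estimates[OF K' sym' ax det'] by metis
  define P where "P = 4 * sqrt 2 + (4 - 2 * sqrt 2) * \<sigma>"
  have P: "0 \<le> P" using \<sigma> sqrt2_less_2 by (simp add: P_def)
  have area: "area K = r\<^sup>2 * area K'"
    unfolding KT using K'(2) by (simp add: area_matrix_image lmeasurable_compact detT)
  have perim: "perimeter K \<le> r * P"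
  proof -
    have "hausdorff1 (frontier K) = hausdorff1 ((*v) T ` frontier K')"
      using r K'(2) by (simp add: KT frontier_matrix_image detT compact_imp_closed)
    also have "\<dots> \<le> ennreal r * hausdorff1 (frontier K')"
      using r by (intro hausdorff1_lipschitz_image) (auto simp: distT)
    also have "\<dots> \<le> ennreal r * ennreal P"
      using len by (intro mult_left_mono) (auto simp: P_def)
    also have "\<dots> = ennreal (r * P)" using r P by (simp add: ennreal_mult)
    finally have "enn2real (hausdorff1 (frontier K)) \<le> enn2real (ennreal (r * P))"
      by (intro enn2real_mono) auto
    then show ?thesis using r P by (simp add: perimeter_def)
  qed
  \<comment> \<open>The image of the diamond in the original coordinates, as a linear image of the square.\<close>
  define A where "A = T ** diamond_matrix"
  have A: "(*v) A ` W2 = (*v) T ` diamond"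
    by (simp add: A_def diamond_eq_image image_image matrix_vector_mul_assoc)
  have detA: "0 < det A" using r by (simp add: A_def det_mul detT det_diamond_matrix)
  have AK: "(*v) A ` W2 \<subseteq> K"
    unfolding A KT by (intro image_mono diamond_subset_convex K' sym' ax)
  have areaA: "area ((*v) A ` W2) = r\<^sup>2 * 2"
    unfolding A by (simp add: area_matrix_image lmeasurable_diamond area_diamond detT)
  have "\<epsilon> \<le> \<sigma> \<or> \<epsilon> \<le> 2 * (1 - 2 / area K')"
    using assms(5)
  proof
    assume "delta_vol K W2 \<ge> \<epsilon>"
    also have "delta_vol K W2 \<le> 2 * (1 - area ((*v) A ` W2) / area K)"
      by (rule delta_vol_le[OF detA AK K(1)])
    also have "area ((*v) A ` W2) / area K = 2 / area K'"
      using r by (simp add: areaA area)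
    finally show ?thesis by simp
  next
    assume "delta_BM K W2 \<ge> \<epsilon>"
    also have "delta_BM K W2 \<le> ln (1 + \<sigma>)"
    proof (rule delta_BM_le[OF _ AK])
      show "invertible A" using detA by (simp add: invertible_det_nz)
      have "K \<subseteq> (*v) T ` (*\<^sub>R) (1 + \<sigma>) ` diamond"
        unfolding KT by (intro image_mono \<sigma>)
      also have "\<dots> = (*\<^sub>R) (1 + \<sigma>) ` (*v) A ` W2"
        unfolding A by (simp add: image_image matrix_vector_mult_scaleR)
      finally show "K \<subseteq> (*\<^sub>R) (1 + \<sigma>) ` (*v) A ` W2" .
    qed (use \<sigma> in simp)
    also have "ln (1 + \<sigma>) \<le> \<sigma>" using \<sigma> by (intro ln_add_one_self_le_self)
    finally show ?thesis by simp
  qed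
  then have num: "P\<^sup>2 \<le> (1 - \<epsilon> / 54) * 16 * area K'"
    using isoperimetric_inequality_numeric[of \<sigma> "area K' - 2" \<epsilon>] \<sigma> by (simp add: P_def)
  have "(perimeter K)\<^sup>2 / area K \<le> (r * P)\<^sup>2 / (r\<^sup>2 * area K')"
    unfolding area using perim \<sigma>
    by (intro divide_right_mono power_mono) (auto simp: perimeter_def)
  also have "\<dots> = P\<^sup>2 / area K'" using r by (simp add: power_mult_distrib)
  also have "\<dots> \<le> (1 - \<epsilon> / 54) * 16"
    using num \<sigma> by (simp add: divide_le_eq)
  finally show ?thesis by (simp add: perimeter_W2 area_W2)
qed

end
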